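(* There exists $\varepsilon_0>0$ such that for all $\varepsilon\in(0,\varepsilon_0)$ the following holds. Let $\mathbf{T}$ be a rooted Galton--Watson tree with offspring distribution $\mathrm{Pois}(1-\varepsilon)$. Then $$\mathbb{E}\ln f(\mathbf{T})>\frac{0.003}{\varepsilon}.$$
   Context: For a finite rooted tree $T$ with root $R$, $f(T)$ denotes the number of non-isomorphic subtrees of $T$ rooted in $R$: that is, the number of isomorphism classes, as rooted trees (isomorphisms map root to root), of the (non-empty) connected subgraphs of $T$ containing $R$, each regarded as a tree rooted at $R$. $\mathrm{Pois}(\lambda)$ is the Poisson distribution with mean $\lambda$. The Galton--Watson tree with offspring distribution $\mathrm{Pois}(1-\varepsilon)$ is the random rooted tree in which every vertex independently has a $\mathrm{Pois}(1-\varepsilon)$ number of children; it is almost surely finite. *)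

theory Defs
  imports "HOL-Probability.Probability"
begin

record 'v rooted_graph =
  verts :: "'v set"
  edges :: "'v set set"
  root :: 'v

definition adj :: "'v rooted_graph \<Rightarrow> ('v \<times> 'v) set" where
  "adj G = {(u, v). {u, v} \<in> edges G}"

definition connected_graph :: "'v rooted_graph \<Rightarrow> bool" where
  "connected_graph G \<longleftrightarrow> (\<forall>u\<in>verts G. \<forall>v\<in>verts G. (u, v) \<in> (adj G)\<^sup>*)"

definition rooted_subtree :: "'v rooted_graph \<Rightarrow> 'v rooted_graph \<Rightarrow> bool" where
  "rooted_subtree S T \<longleftrightarrow>
     verts S \<subseteq> verts T \<and> edges S \<subseteq> edges T \<and> \<Union> (edges S) \<subseteq> verts S \<and>
     root S = root T \<and> root T \<in> verts S \<and> connected_graph S"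

definition rooted_iso :: "'v rooted_graph \<Rightarrow> 'w rooted_graph \<Rightarrow> bool" where
  "rooted_iso G H \<longleftrightarrow>
     (\<exists>\<phi>. bij_betw \<phi> (verts G) (verts H) \<and> \<phi> (root G) = root H \<and>
        (\<forall>u\<in>verts G. \<forall>v\<in>verts G. {u, v} \<in> edges G \<longleftrightarrow> {\<phi> u, \<phi> v} \<in> edges H))"

(* The number f(T) of the non-isomorphic subtrees of the finite rooted tree T that are
   rooted in its root. If there are infinitely many isomorphism classes, card returns 0. *)
definition num_subtrees :: "'v rooted_graph \<Rightarrow> nat" where
  "num_subtrees T =
     card ({S. rooted_subtree S T} //
       {(S, S'). rooted_subtree S T \<and> rooted_subtree S' T \<and> rooted_iso S S'})"

(* Ulam-Harris coding: the root is the empty list, the children of the vertex u are the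
   lists u @ [i] with i < X u, so X u is the number of children of u. *)
inductive_set uh_verts :: "(nat list \<Rightarrow> nat) \<Rightarrow> nat list set"
  for X :: "nat list \<Rightarrow> nat" where
  root: "[] \<in> uh_verts X"
| child: "u \<in> uh_verts X \<Longrightarrow> i < X u \<Longrightarrow> u @ [i] \<in> uh_verts X"

definition uh_tree :: "(nat list \<Rightarrow> nat) \<Rightarrow> nat list rooted_graph" where
  "uh_tree X = \<lparr>verts = uh_verts X,
                edges = {{u, u @ [i]} | u i. u \<in> uh_verts X \<and> i < X u},
                root = []\<rparr>"

(* Under this law of X, the random tree uh_tree X is the Galton-Watson tree with offspring
   distribution p. *)
definition gw_offspring :: "nat pmf \<Rightarrow> (nat list \<Rightarrow> nat) measure" where
  "gw_offspring p = (\<Pi>\<^sub>M u\<in>UNIV. measure_pmf p)"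

end

theory Submission
  imports Defs "HOL-Combinatorics.Permutations"
begin

text \<open>
  Let $d$ be the number of children of the root and $T_1, \ldots, T_d$ the branches. A subtree is
  given by a choice, in each branch, of a subtree or of nothing, and at most $d!$ choices of
  isomorphism classes give the same class, so $f(T) \ge \prod_i (1 + f(T_i)) / d!$. With
  $\mu = 1 - \varepsilon$ and $m = E \ln f(T)$, which is finite since $f(T) \le 4^{|T|}$ and $E|T|$
  is finite, taking expectations gives
  $m \ge \mu (m + E \ln (1 + 1/f(T))) - E \ln D!$ for $D$ distributed as $\mathrm{Pois}(\mu)$, so that
  $\varepsilon m \ge \mu E \ln (1 + 1/f(T)) - E \ln D!$. The two trees with at most two vertices
  contribute about $\ln 2 / e + \ln (3/2) / e^2 > 0.3098$ to the first expectation, while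
  $E \ln D! < 0.305$ for $\mu = 1$.
\<close>

subsection \<open>Subtrees and the branches of the root\<close>

text \<open>The factor 1/\<epsilon> is amplification:
  \<open>ln (1 + f) = ln f + ln (1 + 1/f)\<close>, so a branching step returns the share \<mu> of
  \<open>m\<close> plus a net constant, and this constant accumulates over the
  \<open>1 / (1 - \<mu>)\<close> effective steps. Everything depends on the constant being positive.
  The division by \<open>d!\<close> costs so much that the one-vertex tree alone, with gain about
  0.255, could not pay for it; the tree with one edge turns the balance. What is left exceeds 0.003
  only slightly, so the numerical estimates must be fairly sharp.

  The formal obstacle is that the expectation runs over all offspring functions, also those of
  infinite trees, and that \<open>f\<close> is defined through isomorphism classes. There
  \<open>f = 0\<close> and \<open>ln 0 = 0\<close>, so the integrand is harmless but must be shown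
  to be measurable; this works because \<open>f\<close> sees only the vertex set and there are
  countably many finite vertex sets. Shifting the coordinates of \<open>X\<close> turns a branch
  into a tree with the same law as the whole tree.\<close>

definition subtree_offspring :: "(nat list \<Rightarrow> nat) \<Rightarrow> nat \<Rightarrow> nat list \<Rightarrow> nat" where
  "subtree_offspring X i = (\<lambda>u. X (i # u))"

lemma uh_verts_snoc: "u @ [i] \<in> uh_verts X \<longleftrightarrow> u \<in> uh_verts X \<and> i < X u"
  by (auto intro: uh_verts.child elim: uh_verts.cases)

lemma uh_verts_Cons:
  "i # w \<in> uh_verts X \<longleftrightarrow> i < X [] \<and> w \<in> uh_verts (subtree_offspring X i)"
proof (induction w rule: rev_induct)
  case Nil
  show ?case
    using uh_verts_snoc[of "[]" i X] by (simp add: uh_verts.root)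
next
  case (snoc j w)
  then show ?case
    using uh_verts_snoc[of "i # w" j X] uh_verts_snoc[of w j "subtree_offspring X i"]
    by (auto simp: subtree_offspring_def)
qed

lemma uh_verts_rec:
  "uh_verts X = insert [] (\<Union>i<X []. (#) i ` uh_verts (subtree_offspring X i))"
proof (rule set_eqI)
  fix u
  show "u \<in> uh_verts X \<longleftrightarrow> u \<in> insert [] (\<Union>i<X []. (#) i ` uh_verts (subtree_offspring X i))"
    by (cases u) (auto simp: uh_verts_Cons uh_verts.root)
qed

lemma edges_uh_tree: "edges (uh_tree X) = {{u, u @ [i]} | u i. u @ [i] \<in> uh_verts X}"
  by (simp add: uh_tree_def uh_verts_snoc)

text \<open>The edges are determined by the vertices, so values of \<open>X\<close> off the tree are
  invisible. This later reduces measurability in \<open>X\<close> to a question about vertex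
  sets.\<close>

lemma uh_tree_eqI: "uh_verts X = uh_verts Y \<Longrightarrow> uh_tree X = uh_tree Y"
  using edges_uh_tree[of X] edges_uh_tree[of Y] by (simp add: uh_tree_def)

section \<open>Connectedness, rooted isomorphism and isomorphism classes\<close>

lemma adj_sym: "(u, v) \<in> adj G \<longleftrightarrow> (v, u) \<in> adj G"
  by (simp add: adj_def insert_commute)

lemma adj_rtrancl_sym: "(u, v) \<in> (adj G)\<^sup>* \<Longrightarrow> (v, u) \<in> (adj G)\<^sup>*"
  using sym_rtrancl[of "adj G"] adj_sym[of _ _ G] by (auto simp: sym_def)

lemma connected_graphI:
  assumes "\<And>v. v \<in> verts G \<Longrightarrow> (r, v) \<in> (adj G)\<^sup>*"
  shows "connected_graph G"
  unfolding connected_graph_def using assms adj_rtrancl_sym rtrancl_trans by metis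

lemma rooted_iso_refl: "rooted_iso G G"
  unfolding rooted_iso_def by (intro exI[of _ id]) auto

lemma rooted_iso_sym:
  assumes "rooted_iso G H" "root G \<in> verts G"
  shows "rooted_iso H G"
proof -
  obtain f where f: "bij_betw f (verts G) (verts H)" "f (root G) = root H"
    "\<forall>u\<in>verts G. \<forall>v\<in>verts G. {u, v} \<in> edges G \<longleftrightarrow> {f u, f v} \<in> edges H"
    using assms unfolding rooted_iso_def by blast
  let ?g = "inv_into (verts G) f"
  have g: "bij_betw ?g (verts H) (verts G)" using f(1) by (rule bij_betw_inv_into)
  have "?g (root H) = root G"
    using f assms(2) by (metis bij_betw_inv_into_left)
  moreover have "{u, v} \<in> edges H \<longleftrightarrow> {?g u, ?g v} \<in> edges G"
    if "u \<in> verts H" "v \<in> verts H" for u v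
    using f(3) bij_betwE[OF g] bij_betw_inv_into_right[OF f(1)] that by simp
  ultimately show ?thesis unfolding rooted_iso_def using g by blast
qed

lemma rooted_iso_trans:
  assumes "rooted_iso G H" "rooted_iso H K"
  shows "rooted_iso G K"
proof -
  obtain f g where f: "bij_betw f (verts G) (verts H)" "f (root G) = root H"
    "\<forall>u\<in>verts G. \<forall>v\<in>verts G. {u, v} \<in> edges G \<longleftrightarrow> {f u, f v} \<in> edges H"
    and g: "bij_betw g (verts H) (verts K)" "g (root H) = root K"
    "\<forall>u\<in>verts H. \<forall>v\<in>verts H. {u, v} \<in> edges H \<longleftrightarrow> {g u, g v} \<in> edges K"
    using assms unfolding rooted_iso_def by metis
  have "bij_betw (g \<circ> f) (verts G) (verts K)" using f(1) g(1) by (rule bij_betw_trans)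
  moreover have "{u, v} \<in> edges G \<longleftrightarrow> {(g \<circ> f) u, (g \<circ> f) v} \<in> edges K"
    if "u \<in> verts G" "v \<in> verts G" for u v
    using that f g bij_betwE[OF f(1)] by simp
  ultimately show ?thesis unfolding rooted_iso_def using f(2) g(2)
    by (intro exI[of _ "g \<circ> f"]) auto
qed

text \<open>Classes taken in the type of all graphs, so that the classes of subtrees of different trees
  can be compared. Requiring the root to be a vertex makes isomorphism symmetric.\<close>
definition iso_class :: "'v rooted_graph \<Rightarrow> 'v rooted_graph set" where
  "iso_class G = {H. root H \<in> verts H \<and> rooted_iso G H}"

lemma iso_class_eq_iff:
  assumes "root G \<in> verts G" "root H \<in> verts H"
  shows "iso_class G = iso_class H \<longleftrightarrow> rooted_iso G H"
  using assms unfolding iso_class_def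
  by (smt (verit) Collect_cong mem_Collect_eq rooted_iso_refl rooted_iso_sym rooted_iso_trans)

lemma rooted_subtree_root: "rooted_subtree S T \<Longrightarrow> root S \<in> verts S"
  by (simp add: rooted_subtree_def)

text \<open>A block of the quotient is the trace of a full class on the subtrees of
  \<open>T\<close>. Distinct classes leave distinct traces, because each trace contains the subtree
  that generates the class.\<close>

lemma num_subtrees_eq: "num_subtrees T = card (iso_class ` {S. rooted_subtree S T})"
proof -
  let ?A = "{S. rooted_subtree S T}"
  let ?r = "{(S, S'). rooted_subtree S T \<and> rooted_subtree S' T \<and> rooted_iso S S'}"
  have r: "?r `` {S} = iso_class S \<inter> ?A" if "S \<in> ?A" for S
    using that by (auto simp: iso_class_def rooted_subtree_root)
  have "?A // ?r = (\<lambda>C. C \<inter> ?A) ` iso_class ` ?A"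
    unfolding quotient_def using r by auto
  moreover have "inj_on (\<lambda>C. C \<inter> ?A) (iso_class ` ?A)"
  proof (rule inj_onI)
    fix C C' assume "C \<in> iso_class ` ?A" "C' \<in> iso_class ` ?A" and eq: "C \<inter> ?A = C' \<inter> ?A"
    then obtain S S' where S: "S \<in> ?A" "C = iso_class S" "S' \<in> ?A" "C' = iso_class S'"
      by blast
    have "S' \<in> C'" using S by (simp add: iso_class_def rooted_iso_refl rooted_subtree_root)
    then have "S' \<in> C" using eq S(3) by blast
    then have "rooted_iso S S'" using S by (simp add: iso_class_def)
    then show "C = C'" using S iso_class_eq_iff[of S S'] by (simp add: rooted_subtree_root)
  qed
  ultimately show ?thesis
    unfolding num_subtrees_def by (simp add: card_image)
qed

text \<open>Realises a choice of subtrees in the branches: \<open>A\<close> holds the branches in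
  which something is picked. Values of \<open>S\<close> outside \<open>A\<close> do not enter, so an
  empty pick needs no dummy tree.\<close>

definition graft :: "nat set \<Rightarrow> (nat \<Rightarrow> nat list rooted_graph) \<Rightarrow> nat list rooted_graph" where
  "graft A S = \<lparr>verts = insert [] (\<Union>i\<in>A. (#) i ` verts (S i)),
     edges = (\<lambda>i. {[], [i]}) ` A \<union> (\<Union>i\<in>A. (`) ((#) i) ` edges (S i)), root = []\<rparr>"

lemma verts_graft_Nil: "[] \<in> verts (graft A S)"
  and verts_graft_Cons: "i # w \<in> verts (graft A S) \<longleftrightarrow> i \<in> A \<and> w \<in> verts (S i)"
  and root_graft: "root (graft A S) = []"
  by (auto simp: graft_def)

lemma image_Cons_eq_doubleton:
  "(#) k ` e = {i # u, j # v} \<longleftrightarrow> k = i \<and> k = j \<and> e = {u, v}"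
proof
  assume *: "(#) k ` e = {i # u, j # v}"
  have "i # u \<in> (#) k ` e" "j # v \<in> (#) k ` e" unfolding * by auto
  then have k: "i = k" "j = k" by auto
  have "(#) k ` e = (#) k ` {u, v}" using * k by auto
  then show "k = i \<and> k = j \<and> e = {u, v}"
    using k inj_image_eq_iff[of "(#) k" e "{u, v}"] by simp
qed auto

lemma edges_graft_Cons_Cons:
  "{i # u, j # v} \<in> edges (graft A S) \<longleftrightarrow> i \<in> A \<and> i = j \<and> {u, v} \<in> edges (S i)"
proof -
  have "{i # u, j # v} \<noteq> {[], [k]}" for k by auto
  then have "{i # u, j # v} \<notin> (\<lambda>k. {[], [k]}) ` A" by blast
  then have "{i # u, j # v} \<in> edges (graft A S) \<longleftrightarrow>
      (\<exists>k\<in>A. \<exists>e\<in>edges (S k). (#) k ` e = {i # u, j # v})"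
    by (simp add: graft_def image_iff eq_commute)
  then show ?thesis by (auto simp: image_Cons_eq_doubleton)
qed

lemma edges_graft_Nil_Cons: "{[], i # v} \<in> edges (graft A S) \<longleftrightarrow> i \<in> A \<and> v = []"
proof -
  have "{[], i # v} \<noteq> (#) k ` e" for k e by auto
  then show ?thesis by (auto simp: graft_def doubleton_eq_iff)
qed

lemma rooted_subtree_graft:
  assumes A: "A \<subseteq> {..<X []}"
    and S: "\<And>i. i \<in> A \<Longrightarrow> rooted_subtree (S i) (uh_tree (subtree_offspring X i))"
  shows "rooted_subtree (graft A S) (uh_tree X)"
proof -
  have vS: "verts (S i) \<subseteq> uh_verts (subtree_offspring X i)"
    and eS: "edges (S i) \<subseteq> edges (uh_tree (subtree_offspring X i))"
    and evS: "\<Union>(edges (S i)) \<subseteq> verts (S i)" and rS: "[] \<in> verts (S i)"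
    and cS: "connected_graph (S i)" if "i \<in> A" for i
    using S[OF that] by (auto simp: rooted_subtree_def uh_tree_def)
  have "verts (graft A S) \<subseteq> verts (uh_tree X)"
    using vS A by (fastforce simp: graft_def uh_tree_def uh_verts_Cons uh_verts.root)
  moreover have "edges (graft A S) \<subseteq> edges (uh_tree X)"
  proof
    fix e assume "e \<in> edges (graft A S)"
    then consider i where "i \<in> A" "e = {[], [i]}"
      | i e' where "i \<in> A" "e' \<in> edges (S i)" "e = (#) i ` e'"
      by (auto simp: graft_def)
    then show "e \<in> edges (uh_tree X)"
    proof cases
      case 1
      then have "[] @ [i] \<in> uh_verts X" using A by (auto simp: uh_verts_Cons uh_verts.root)
      then show ?thesis unfolding edges_uh_tree using 1 by blast
    next
      case 2
      then obtain u j where u: "e' = {u, u @ [j]}" "u @ [j] \<in> uh_verts (subtree_offspring X i)"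
        using eS unfolding edges_uh_tree by blast
      have "(i # u) @ [j] \<in> uh_verts X" using u(2) 2(1) A by (auto simp: uh_verts_Cons)
      moreover have "e = {i # u, (i # u) @ [j]}" using 2(3) u(1) by auto
      ultimately show ?thesis unfolding edges_uh_tree by blast
    qed
  qed
  moreover have "\<Union>(edges (graft A S)) \<subseteq> verts (graft A S)"
    using evS rS by (fastforce simp: graft_def)
  moreover have "connected_graph (graft A S)"
  proof (rule connected_graphI[of _ "[]"])
    fix v assume v: "v \<in> verts (graft A S)"
    show "([], v) \<in> (adj (graft A S))\<^sup>*"
    proof (cases v)
      case (Cons i w)
      with v have i: "i \<in> A" "w \<in> verts (S i)" by (auto simp: verts_graft_Cons)
      have "([], w) \<in> (adj (S i))\<^sup>*"
        using cS[OF i(1)] rS[OF i(1)] i(2) by (auto simp: connected_graph_def)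
      then have "([], i # w) \<in> (adj (graft A S))\<^sup>*"
      proof induction
        case base
        have "([], [i]) \<in> adj (graft A S)"
          using i by (auto simp: adj_def edges_graft_Nil_Cons)
        then show ?case by blast
      next
        case (step y z)
        have "(i # y, i # z) \<in> adj (graft A S)"
          using i step(2) by (auto simp: adj_def edges_graft_Cons_Cons)
        then show ?case using step.IH by (rule rtrancl_into_rtrancl[rotated])
      qed
      then show ?thesis using Cons by simp
    qed simp
  qed
  ultimately show ?thesis
    by (simp add: rooted_subtree_def verts_graft_Nil root_graft uh_tree_def)
qed

text \<open>An isomorphism of grafts fixes the root, so it sends neighbours of the root to neighbours
  of the root, and paths that avoid the root to such paths.\<close>
lemma graft_iso_branch:
  assumes f: "bij_betw f (verts (graft A S)) (verts (graft B S'))" "f [] = []"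
    "\<forall>u\<in>verts (graft A S). \<forall>v\<in>verts (graft A S).
       {u, v} \<in> edges (graft A S) \<longrightarrow> {f u, f v} \<in> edges (graft B S')"
    and S: "connected_graph (S i)" "[] \<in> verts (S i)" "\<Union>(edges (S i)) \<subseteq> verts (S i)"
    and i: "i \<in> A"
  obtains j where "j \<in> B" "f [i] = [j]" "\<And>w. w \<in> verts (S i) \<Longrightarrow> \<exists>w'\<in>verts (S' j). f (i # w) = j # w'"
proof -
  have ne: "f (i # w) \<noteq> []" and vf: "f (i # w) \<in> verts (graft B S')" if "w \<in> verts (S i)" for w
  proof -
    have "i # w \<in> verts (graft A S)" using that i by (simp add: verts_graft_Cons)
    then show "f (i # w) \<noteq> []"
      using bij_betw_imp_inj_on[OF f(1)] f(2) verts_graft_Nil[of A S]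
      by (metis inj_onD list.distinct(1))
    show "f (i # w) \<in> verts (graft B S')"
      using \<open>i # w \<in> verts (graft A S)\<close> bij_betwE[OF f(1)] by blast
  qed
  have "{[], [i]} \<in> edges (graft A S)" using i by (simp add: edges_graft_Nil_Cons)
  then have "{[], f [i]} \<in> edges (graft B S')"
    using f(2,3) verts_graft_Nil verts_graft_Cons i S(2) by metis
  then obtain j where j: "j \<in> B" "f [i] = [j]"
    using ne[OF S(2)] by (cases "f [i]") (auto simp: edges_graft_Nil_Cons)
  have "\<exists>w'\<in>verts (S' j). f (i # w) = j # w'" if w: "w \<in> verts (S i)" for w
  proof -
    have "([], w) \<in> (adj (S i))\<^sup>*" using S w by (auto simp: connected_graph_def)
    then show ?thesis
    proof induction
      case base
      then show ?case using vf[OF S(2)] j by (auto simp: verts_graft_Cons)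
    next
      case (step y z)
      then obtain y' where y': "f (i # y) = j # y'" by blast
      have yz: "{y, z} \<in> edges (S i)" using step(2) by (simp add: adj_def)
      then have v: "y \<in> verts (S i)" "z \<in> verts (S i)" using S(3) by auto
      have "{i # y, i # z} \<in> edges (graft A S)" using yz i by (simp add: edges_graft_Cons_Cons)
      then have "{f (i # y), f (i # z)} \<in> edges (graft B S')"
        using f(3) v i verts_graft_Cons by metis
      moreover obtain k z' where z': "f (i # z) = k # z'"
        using ne[OF v(2)] by (cases "f (i # z)") auto
      \<comment> \<open>No edge of a graft joins two different branches, so a path that avoids the
        root stays in its branch.\<close>
      ultimately have "k = j" using y' by (auto simp: edges_graft_Cons_Cons)
      then show ?case using vf[OF v(2)] z' by (auto simp: verts_graft_Cons)
    qed
  qed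
  then show thesis using that j by blast
qed

text \<open>The branch lemma applied to \<open>f\<close> gives \<sigma>, applied to the inverse of
  \<open>f\<close> it gives \<tau>. They are mutually inverse because they are read off from the
  images of the neighbours of the root, and \<open>f\<close> cut down to one branch is the
  isomorphism sought.\<close>

lemma rooted_iso_graftD:
  assumes iso: "rooted_iso (graft A S) (graft B S')"
    and S: "\<And>i. i \<in> A \<Longrightarrow> connected_graph (S i) \<and> root (S i) = [] \<and> [] \<in> verts (S i) \<and>
      \<Union>(edges (S i)) \<subseteq> verts (S i)"
    and S': "\<And>i. i \<in> B \<Longrightarrow> connected_graph (S' i) \<and> root (S' i) = [] \<and> [] \<in> verts (S' i) \<and>
      \<Union>(edges (S' i)) \<subseteq> verts (S' i)"
  shows "\<exists>\<sigma>. bij_betw \<sigma> A B \<and> (\<forall>i\<in>A. rooted_iso (S i) (S' (\<sigma> i)))"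
proof -
  let ?G = "graft A S" and ?H = "graft B S'"
  obtain f where f: "bij_betw f (verts ?G) (verts ?H)" "f [] = []"
    "\<forall>u\<in>verts ?G. \<forall>v\<in>verts ?G. {u, v} \<in> edges ?G \<longleftrightarrow> {f u, f v} \<in> edges ?H"
    using iso unfolding rooted_iso_def root_graft by blast
  let ?g = "inv_into (verts ?G) f"
  have g: "bij_betw ?g (verts ?H) (verts ?G)" using f(1) by (rule bij_betw_inv_into)
  have gf: "?g (f u) = u" if "u \<in> verts ?G" for u
    using f(1) that by (rule bij_betw_inv_into_left)
  have fg: "f (?g u) = u" if "u \<in> verts ?H" for u
    using f(1) that by (rule bij_betw_inv_into_right)
  have g0: "?g [] = []" using gf[OF verts_graft_Nil] f(2) by simp
  have g2: "\<forall>u\<in>verts ?H. \<forall>v\<in>verts ?H. {u, v} \<in> edges ?H \<longrightarrow> {?g u, ?g v} \<in> edges ?G"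
    using f(3) fg bij_betwE[OF g] by metis
  have f2: "\<forall>u\<in>verts ?G. \<forall>v\<in>verts ?G. {u, v} \<in> edges ?G \<longrightarrow> {f u, f v} \<in> edges ?H"
    using f(3) by blast
  have "\<exists>j. j \<in> B \<and> f [i] = [j] \<and> (\<forall>w\<in>verts (S i). \<exists>w'\<in>verts (S' j). f (i # w) = j # w')"
    if "i \<in> A" for i
    using graft_iso_branch[OF f(1,2) f2, of i] S[OF that] that by metis
  then obtain \<sigma> where \<sigma>: "\<And>i. i \<in> A \<Longrightarrow> \<sigma> i \<in> B" "\<And>i. i \<in> A \<Longrightarrow> f [i] = [\<sigma> i]"
    "\<And>i w. i \<in> A \<Longrightarrow> w \<in> verts (S i) \<Longrightarrow> \<exists>w'\<in>verts (S' (\<sigma> i)). f (i # w) = \<sigma> i # w'"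
    by metis
  have "\<exists>j. j \<in> A \<and> ?g [i] = [j] \<and> (\<forall>w\<in>verts (S' i). \<exists>w'\<in>verts (S j). ?g (i # w) = j # w')"
    if "i \<in> B" for i
    using graft_iso_branch[OF g g0 g2, of i] S'[OF that] that by metis
  then obtain \<tau> where \<tau>: "\<And>i. i \<in> B \<Longrightarrow> \<tau> i \<in> A" "\<And>i. i \<in> B \<Longrightarrow> ?g [i] = [\<tau> i]"
    "\<And>i w. i \<in> B \<Longrightarrow> w \<in> verts (S' i) \<Longrightarrow> \<exists>w'\<in>verts (S (\<tau> i)). ?g (i # w) = \<tau> i # w'"
    by metis
  have \<tau>\<sigma>: "\<tau> (\<sigma> i) = i" if "i \<in> A" for i
    using gf[of "[i]"] \<sigma>(1,2)[OF that] \<tau>(2) S[OF that] that by (simp add: verts_graft_Cons)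
  have \<sigma>\<tau>: "\<sigma> (\<tau> i) = i" if "i \<in> B" for i
    using fg[of "[i]"] \<tau>(1,2)[OF that] \<sigma>(2) S'[OF that] that by (simp add: verts_graft_Cons)
  have "bij_betw \<sigma> A B"
    by (rule bij_betw_byWitness[where f' = \<tau>]) (use \<tau>\<sigma> \<sigma>\<tau> \<sigma>(1) \<tau>(1) in auto)
  moreover have "rooted_iso (S i) (S' (\<sigma> i))" if i: "i \<in> A" for i
  proof -
    \<comment> \<open>\<open>f\<close> on branch \<open>i\<close>, with the leading letter removed
      from argument and value.\<close>
    define h where "h = (\<lambda>w. tl (f (i # w)))"
    have h: "f (i # w) = \<sigma> i # h w" "h w \<in> verts (S' (\<sigma> i))" if "w \<in> verts (S i)" for w
      using \<sigma>(3)[OF i that] by (auto simp: h_def)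
    have vi: "i # w \<in> verts ?G" if "w \<in> verts (S i)" for w
      using that i by (simp add: verts_graft_Cons)
    have "bij_betw h (verts (S i)) (verts (S' (\<sigma> i)))"
    proof (rule bij_betw_imageI)
      show "inj_on h (verts (S i))"
      proof (rule inj_onI)
        fix u v assume uv: "u \<in> verts (S i)" "v \<in> verts (S i)" "h u = h v"
        then have "f (i # u) = f (i # v)" using h(1) by simp
        then show "u = v" using vi[OF uv(1)] vi[OF uv(2)] bij_betw_imp_inj_on[OF f(1)]
          by (metis inj_onD list.inject)
      qed
      show "h ` verts (S i) = verts (S' (\<sigma> i))"
      proof
        show "verts (S' (\<sigma> i)) \<subseteq> h ` verts (S i)"
        proof
          fix w assume w: "w \<in> verts (S' (\<sigma> i))"
          \<comment> \<open>Surjectivity: the inverse of \<open>f\<close> sends branch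
            \<open>\<sigma> i\<close> into branch \<open>\<tau> (\<sigma> i) = i\<close>.\<close>
          obtain u where u: "u \<in> verts (S i)" "?g (\<sigma> i # w) = i # u"
            using \<tau>(3)[OF \<sigma>(1)[OF i] w] \<tau>\<sigma>[OF i] by auto
          have "f (i # u) = \<sigma> i # w"
            using fg[of "\<sigma> i # w"] u(2) w \<sigma>(1)[OF i] by (simp add: verts_graft_Cons)
          then have "h u = w" by (simp add: h_def)
          then show "w \<in> h ` verts (S i)" using u(1) by blast
        qed
      qed (use h(2) in auto)
    qed
    moreover have "h (root (S i)) = root (S' (\<sigma> i))"
      using S[OF i] S'[OF \<sigma>(1)[OF i]] \<sigma>(2)[OF i] by (simp add: h_def)
    moreover have "{u, v} \<in> edges (S i) \<longleftrightarrow> {h u, h v} \<in> edges (S' (\<sigma> i))"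
      if "u \<in> verts (S i)" "v \<in> verts (S i)" for u v
    proof -
      have "{i # u, i # v} \<in> edges ?G \<longleftrightarrow> {f (i # u), f (i # v)} \<in> edges ?H"
        using f(3) vi that by blast
      then show ?thesis using i \<sigma>(1)[OF i]
        by (simp add: h(1) that edges_graft_Cons_Cons)
    qed
    ultimately show ?thesis unfolding rooted_iso_def by blast
  qed
  ultimately show ?thesis by blast
qed

text \<open>A fibre of \<open>K\<close> lies in the orbit of any one of its members under the
  permutations of \<open>D\<close>, so it has at most \<open>fact (card D)\<close> elements.
  Extensionality makes a tuple determined by its values on \<open>D\<close>.\<close>

lemma card_le_fact_mult_card_image:
  assumes "finite D" "finite P" "P \<subseteq> extensional D"
    and perm: "\<And>p q. p \<in> P \<Longrightarrow> q \<in> P \<Longrightarrow> K p = K q \<Longrightarrow>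
      \<exists>\<sigma>. \<sigma> permutes D \<and> (\<forall>i\<in>D. q i = p (\<sigma> i))"
  shows "card P \<le> fact (card D) * card (K ` P)"
proof -
  have fib: "card {p \<in> P. K p = k} \<le> fact (card D)" if k: "k \<in> K ` P" for k
  proof -
    obtain p where p: "p \<in> P" "k = K p" using k by blast
    have "{q \<in> P. K q = k} \<subseteq> (\<lambda>\<sigma>. restrict (p \<circ> \<sigma>) D) ` {\<sigma>. \<sigma> permutes D}"
    proof
      fix q assume q: "q \<in> {q \<in> P. K q = k}"
      then obtain \<sigma> where \<sigma>: "\<sigma> permutes D" "\<forall>i\<in>D. q i = p (\<sigma> i)"
        using perm[OF p(1), of q] p(2) by auto
      have "q = restrict (p \<circ> \<sigma>) D"
        using q assms(3) \<sigma>(2) by (intro extensionalityI[of q D]) auto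
      then show "q \<in> (\<lambda>\<sigma>. restrict (p \<circ> \<sigma>) D) ` {\<sigma>. \<sigma> permutes D}" using \<sigma>(1) by blast
    qed
    then have "card {q \<in> P. K q = k} \<le> card {\<sigma>. \<sigma> permutes D}"
      using finite_permutations[OF assms(1)] by (rule surj_card_le[rotated])
    then show ?thesis using card_permutations[OF refl assms(1)] by simp
  qed
  have "P = (\<Union>k\<in>K ` P. {p \<in> P. K p = k})" by auto
  then have "card P \<le> (\<Sum>k\<in>K ` P. card {p \<in> P. K p = k})"
    using card_UN_le[of "K ` P" "\<lambda>k. {p \<in> P. K p = k}"] assms(2) by simp
  also have "\<dots> \<le> of_nat (card (K ` P)) * fact (card D)"
    using fib by (rule sum_bounded_above)
  finally show ?thesis by (simp add: mult.commute)
qed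

text \<open>A subtree is fixed by its vertices and its edges, and an edge of the tree is fixed by
  its lower endpoint, so both sets are chosen in at most \<open>2 ^ card V\<close> ways, where
  \<open>V\<close> is the vertex set of the tree. Only a bound whose logarithm is linear in the size
  of the tree matters later.\<close>

lemma finite_rooted_subtrees:
  assumes "finite (uh_verts X)"
  shows "finite {S. rooted_subtree S (uh_tree X)}"
    and "card {S. rooted_subtree S (uh_tree X)} \<le> 4 ^ card (uh_verts X)"
proof -
  let ?V = "uh_verts X" and ?E = "edges (uh_tree X)"
  have E: "?E \<subseteq> (\<lambda>u. {butlast u, u}) ` ?V"
    unfolding edges_uh_tree by (auto simp: image_iff) (metis butlast_snoc)
  then have cE: "card ?E \<le> card ?V" and fE: "finite ?E"
    using assms by (auto intro: surj_card_le finite_subset)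
  let ?R = "(\<lambda>(W, F). \<lparr>verts = W, edges = F, root = []\<rparr>) ` (Pow ?V \<times> Pow ?E)"
  have sub: "{S. rooted_subtree S (uh_tree X)} \<subseteq> ?R"
  proof
    fix S assume "S \<in> {S. rooted_subtree S (uh_tree X)}"
    then have "verts S \<in> Pow ?V" "edges S \<in> Pow ?E" "S = \<lparr>verts = verts S, edges = edges S, root = []\<rparr>"
      by (auto simp: rooted_subtree_def uh_tree_def)
    then show "S \<in> ?R" by (intro image_eqI[of _ _ "(verts S, edges S)"]) auto
  qed
  show "finite {S. rooted_subtree S (uh_tree X)}"
    using sub assms fE by (auto intro: finite_subset)
  have "card {S. rooted_subtree S (uh_tree X)} \<le> card (Pow ?V \<times> Pow ?E)"
    using sub assms fE by (intro surj_card_le) auto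
  also have "\<dots> = 2 ^ card ?V * 2 ^ card ?E"
    by (simp add: card_cartesian_product card_Pow assms fE)
  also have "\<dots> \<le> 2 ^ card ?V * 2 ^ card ?V" using cE by simp
  also have "\<dots> = 4 ^ card ?V" by (simp flip: power_mult_distrib)
  finally show "card {S. rooted_subtree S (uh_tree X)} \<le> 4 ^ card ?V" .
qed

lemma num_subtrees_le:
  assumes "finite (uh_verts X)"
  shows "num_subtrees (uh_tree X) \<le> 4 ^ card (uh_verts X)"
  unfolding num_subtrees_eq
  using card_image_le[OF finite_rooted_subtrees(1)[OF assms], of iso_class]
    finite_rooted_subtrees(2)[OF assms] by linarith

lemma num_subtrees_pos:
  assumes "finite (uh_verts X)"
  shows "num_subtrees (uh_tree X) \<ge> 1"
proof -
  \<comment> \<open>Grafting nothing gives the tree that consists of the root alone.\<close>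
  have "rooted_subtree (graft {} (\<lambda>_. undefined)) (uh_tree X)"
    by (rule rooted_subtree_graft) auto
  then show ?thesis
    using finite_rooted_subtrees(1)[OF assms]
    by (auto simp: num_subtrees_eq Suc_le_eq card_gt_0_iff)
qed

lemma finite_subtree_offspring:
  assumes "finite (uh_verts X)" "i < X []"
  shows "finite (uh_verts (subtree_offspring X i))"
proof (rule finite_imageD[of "(#) i"])
  show "finite ((#) i ` uh_verts (subtree_offspring X i))"
    using assms by (auto simp: uh_verts_Cons intro: finite_subset[of _ "uh_verts X"])
qed simp

text \<open>A tuple that picks a class of subtrees, or nothing, in each branch of the root determines a
  subtree of the whole tree. Two tuples that give isomorphic subtrees differ only by a permutation
  of the branches.\<close>
lemma prod_num_subtrees_le:
  assumes fin: "finite (uh_verts X)"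
  shows "(\<Prod>i<X []. 1 + num_subtrees (uh_tree (subtree_offspring X i)))
    \<le> fact (X []) * num_subtrees (uh_tree X)"
proof -
  let ?D = "{..<X []}"
  let ?T = "\<lambda>i. uh_tree (subtree_offspring X i)"
  define Q where "Q i = iso_class ` {S. rooted_subtree S (?T i)}" for i
  \<comment> \<open>\<open>None\<close> means that nothing is picked in a branch; it accounts for
    the summand 1 in each factor of the product.\<close>
  define P where "P = (\<Pi>\<^sub>E i\<in>?D. insert None (Some ` Q i))"
  have finQ: "finite (Q i)" if "i \<in> ?D" for i
    unfolding Q_def using that finite_rooted_subtrees finite_subtree_offspring[OF fin] by simp
  have finP: "finite P" unfolding P_def using finQ by (intro finite_PiE) auto
  have cardP: "card P = (\<Prod>i<X []. 1 + num_subtrees (?T i))"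
    unfolding P_def using finQ
    by (subst card_PiE) (auto intro!: prod.cong simp: card_insert_if card_image num_subtrees_eq Q_def)
  define A where "A p = {i\<in>?D. p i \<noteq> None}" for p :: "nat \<Rightarrow> nat list rooted_graph set option"
  define R where "R i C = (SOME S. rooted_subtree S (?T i) \<and> iso_class S = C)" for i C
  have R: "rooted_subtree (R i C) (?T i) \<and> iso_class (R i C) = C" if "C \<in> Q i" for i C
    unfolding R_def by (rule someI_ex) (use that in \<open>auto simp: Q_def\<close>)
  define S where "S p i = R i (the (p i))" for p i
  have S: "rooted_subtree (S p i) (?T i)" "p i = Some (iso_class (S p i))"
    if "p \<in> P" "i \<in> A p" for p i
  proof -
    have "p i \<in> insert None (Some ` Q i)" using that unfolding P_def A_def by auto
    then have "the (p i) \<in> Q i" "p i \<noteq> None" using that(2) by (auto simp: A_def)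
    then show "rooted_subtree (S p i) (?T i)" "p i = Some (iso_class (S p i))"
      using R by (auto simp: S_def)
  qed
  have S': "connected_graph (S p i) \<and> root (S p i) = [] \<and> [] \<in> verts (S p i) \<and>
      \<Union>(edges (S p i)) \<subseteq> verts (S p i)" if "p \<in> P" "i \<in> A p" for p i
    using S(1)[OF that] by (auto simp: rooted_subtree_def uh_tree_def)
  define K where "K p = iso_class (graft (A p) (S p))" for p
  have sub: "rooted_subtree (graft (A p) (S p)) (uh_tree X)" if "p \<in> P" for p
    using S(1)[OF that] by (intro rooted_subtree_graft) (auto simp: A_def)
  have "card P \<le> fact (card ?D) * card (K ` P)"
  proof (rule card_le_fact_mult_card_image)
    show "P \<subseteq> extensional ?D" by (auto simp: P_def PiE_def)
    fix p q assume p: "p \<in> P" and q: "q \<in> P" and "K p = K q"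
    then have "rooted_iso (graft (A q) (S q)) (graft (A p) (S p))"
      using iso_class_eq_iff[OF rooted_subtree_root[OF sub[OF q]] rooted_subtree_root[OF sub[OF p]]]
      by (simp add: K_def)
    then have "\<exists>\<sigma>. bij_betw \<sigma> (A q) (A p) \<and> (\<forall>i\<in>A q. rooted_iso (S q i) (S p (\<sigma> i)))"
      by (rule rooted_iso_graftD[OF _ S'[OF q] S'[OF p]])
    then obtain \<sigma> where \<sigma>: "bij_betw \<sigma> (A q) (A p)"
      "\<And>i. i \<in> A q \<Longrightarrow> rooted_iso (S q i) (S p (\<sigma> i))"
      by blast
    have sA: "A q \<subseteq> ?D" "A p \<subseteq> ?D" by (auto simp: A_def)
    have fA: "finite (A q)" "finite (A p)" using sA by (auto intro: finite_subset)
    \<comment> \<open>The isomorphism matches only the branches in which something is picked. Both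
      tuples are \<open>None\<close> on the others, of which there are equally many, so an arbitrary
      bijection \<tau> completes \<sigma> to a permutation.\<close>
    have "card (?D - A q) = card (?D - A p)"
      using bij_betw_same_card[OF \<sigma>(1)] sA fA by (simp add: card_Diff_subset)
    then obtain \<tau> where \<tau>: "bij_betw \<tau> (?D - A q) (?D - A p)"
      using finite_same_card_bij[of "?D - A q" "?D - A p"] by auto
    define \<rho> where "\<rho> i = (if i \<in> A q then \<sigma> i else if i \<in> ?D then \<tau> i else i)" for i
    have "bij_betw \<rho> (A q \<union> (?D - A q)) (A p \<union> (?D - A p))"
    proof (rule bij_betw_combine)
      show "bij_betw \<rho> (A q) (A p)"
        using \<sigma>(1) by (rule bij_betw_cong[THEN iffD1, rotated]) (simp add: \<rho>_def)
      show "bij_betw \<rho> (?D - A q) (?D - A p)"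
        using \<tau> by (rule bij_betw_cong[THEN iffD1, rotated]) (simp add: \<rho>_def)
    qed auto
    then have "bij_betw \<rho> ?D ?D" using sA by (simp add: Un_absorb1)
    then have "\<rho> permutes ?D"
      by (rule bij_imp_permutes) (use sA in \<open>auto simp: \<rho>_def\<close>)
    moreover have "q i = p (\<rho> i)" if "i \<in> ?D" for i
    proof (cases "i \<in> A q")
      case True
      then have "\<sigma> i \<in> A p" using \<sigma>(1) bij_betwE by blast
      have "iso_class (S q i) = iso_class (S p (\<sigma> i))"
        using iso_class_eq_iff[OF rooted_subtree_root[OF S(1)[OF q True]]
            rooted_subtree_root[OF S(1)[OF p \<open>\<sigma> i \<in> A p\<close>]]] \<sigma>(2)[OF True]
        by simp
      then show ?thesis
        using S(2)[OF q True] S(2)[OF p \<open>\<sigma> i \<in> A p\<close>] True by (simp add: \<rho>_def)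
    next
      case False
      then have "\<tau> i \<in> ?D - A p" using that \<tau> bij_betwE by blast
      then show ?thesis using False that by (auto simp: \<rho>_def A_def)
    qed
    ultimately show "\<exists>\<sigma>. \<sigma> permutes ?D \<and> (\<forall>i\<in>?D. q i = p (\<sigma> i))" by blast
  qed (use finP in auto)
  moreover have "card (K ` P) \<le> num_subtrees (uh_tree X)"
    unfolding num_subtrees_eq
    using sub finite_rooted_subtrees(1)[OF fin] by (intro card_mono) (auto simp: K_def)
  ultimately show ?thesis
    unfolding cardP[symmetric] by (simp add: order.trans[OF _ mult_le_mono2])
qed

text \<open>An upper bound is the useful direction for the small trees, because the gain
  \<open>ln (1 + 1/f)\<close> decreases in \<open>f\<close>.\<close>

lemma num_subtrees_leaf:
  assumes "X [] = 0"
  shows "num_subtrees (uh_tree X) \<le> 1"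
proof -
  have V: "uh_verts X = {[]}" using assms by (subst uh_verts_rec) simp
  have E: "edges (uh_tree X) = {}" unfolding edges_uh_tree V by simp
  have "{S. rooted_subtree S (uh_tree X)} \<subseteq> {\<lparr>verts = {[]}, edges = {}, root = []\<rparr>}"
  proof
    fix S assume "S \<in> {S. rooted_subtree S (uh_tree X)}"
    then have "verts S = {[]}" "edges S = {}" "root S = []"
      using E by (auto simp: rooted_subtree_def uh_tree_def V)
    then show "S \<in> {\<lparr>verts = {[]}, edges = {}, root = []\<rparr>}" by simp
  qed
  then have "card (iso_class ` {S. rooted_subtree S (uh_tree X)})
      \<le> card {\<lparr>verts = {[]}, edges = {}, root = []\<rparr> :: nat list rooted_graph}"
    by (rule surj_card_le[rotated, OF image_mono]) simp
  then show ?thesis by (simp add: num_subtrees_eq)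
qed

lemma num_subtrees_edge:
  assumes "X [] = 1" "X [0] = 0"
  shows "num_subtrees (uh_tree X) \<le> 2"
proof -
  have V: "uh_verts X = {[], [0]}"
    using assms by (subst uh_verts_rec, subst uh_verts_rec)
      (simp add: subtree_offspring_def lessThan_Suc)
  have E: "edges (uh_tree X) = {{[], [0]}}"
    unfolding edges_uh_tree V by auto
  let ?A = "{\<lparr>verts = {[]}, edges = {}, root = []\<rparr>,
    \<lparr>verts = {[], [0]}, edges = {{[], [0]}}, root = []\<rparr>} :: nat list rooted_graph set"
  have "{S. rooted_subtree S (uh_tree X)} \<subseteq> ?A"
  proof
    fix S assume "S \<in> {S. rooted_subtree S (uh_tree X)}"
    then have S: "verts S \<subseteq> {[], [0]}" "edges S \<subseteq> {{[], [0]}}" "\<Union>(edges S) \<subseteq> verts S"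
      "root S = []" "[] \<in> verts S" "connected_graph S"
      using V E by (auto simp: rooted_subtree_def uh_tree_def)
    show "S \<in> ?A"
    proof (cases "[0] \<in> verts S")
      case False
      then have "edges S = {}" using S(2,3) by auto
      moreover have "verts S = {[]}" using S(1,5) False by auto
      ultimately show ?thesis using S(4) by simp
    next
      case True
      then have "([], [0]) \<in> (adj S)\<^sup>*" using S(5,6) by (auto simp: connected_graph_def)
      then have "edges S \<noteq> {}" by (auto simp: adj_def elim: rtranclE)
      then have "edges S = {{[], [0]}}" using S(2) by auto
      moreover have "verts S = {[], [0]}" using S(1,5) True by auto
      ultimately show ?thesis using S(4) by simp
    qed
  qed
  then have "card (iso_class ` {S. rooted_subtree S (uh_tree X)}) \<le> card ?A"
    by (rule surj_card_le[rotated, OF image_mono]) simp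
  then show ?thesis by (simp add: num_subtrees_eq)
qed


subsection \<open>Truncations and infinite trees\<close>

text \<open>With the strict inequality the truncation at 0 is empty, so inductions over this
  recursion have a trivial base.\<close>

lemma truncation_Suc:
  "{u \<in> uh_verts X. length u < Suc n} =
     insert [] (\<Union>i<X []. (#) i ` {u \<in> uh_verts (subtree_offspring X i). length u < n})"
  by (subst uh_verts_rec) auto

lemma finite_truncation: "finite {u \<in> uh_verts X. length u < n}"
proof (induction n arbitrary: X)
  case (Suc n)
  then show ?case unfolding truncation_Suc by auto
qed simp

lemma card_truncation_Suc:
  "card {u \<in> uh_verts X. length u < Suc n} =
     1 + (\<Sum>i<X []. card {u \<in> uh_verts (subtree_offspring X i). length u < n})"
proof -
  let ?B = "\<lambda>i. (#) i ` {u \<in> uh_verts (subtree_offspring X i). length u < n}"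
  have "card (\<Union>i<X []. ?B i) = (\<Sum>i<X []. card (?B i))"
    by (rule card_UN_disjoint) (auto simp: finite_truncation)
  also have "\<dots> = (\<Sum>i<X []. card {u \<in> uh_verts (subtree_offspring X i). length u < n})"
    by (simp add: card_image)
  finally show ?thesis
    unfolding truncation_Suc by (subst card_insert_disjoint) (auto simp: finite_truncation)
qed

lemma truncation_superset:
  assumes "finite F" "F \<subseteq> uh_verts X"
  obtains n where "F \<subseteq> {u \<in> uh_verts X. length u < n}"
proof
  show "F \<subseteq> {u \<in> uh_verts X. length u < Suc (Max (length ` F))}"
    using assms by (auto simp: less_Suc_eq_le)
qed

lemma card_truncation_unbounded:
  assumes "infinite (uh_verts X)"
  shows "\<exists>n. card {u \<in> uh_verts X. length u < n} \<ge> k"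
proof -
  obtain F where F: "finite F" "card F = k" "F \<subseteq> uh_verts X"
    using infinite_arbitrarily_large[OF assms] by blast
  obtain n where "F \<subseteq> {u \<in> uh_verts X. length u < n}"
    using truncation_superset[OF F(1,3)] .
  then show ?thesis using card_mono[OF finite_truncation] F(2) by blast
qed

text \<open>The bound on the length is weak here, in contrast to the truncated vertex sets above, so
  that the root is present already for \<open>n = 0\<close> and every truncation is a rooted
  subtree.\<close>

definition truncated_tree :: "(nat list \<Rightarrow> nat) \<Rightarrow> nat \<Rightarrow> nat list rooted_graph" where
  "truncated_tree X n = \<lparr>verts = {u \<in> uh_verts X. length u \<le> n},
     edges = {{u, u @ [i]} | u i. u @ [i] \<in> uh_verts X \<and> length u < n}, root = []\<rparr>"

lemma rooted_subtree_truncated_tree: "rooted_subtree (truncated_tree X n) (uh_tree X)"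
proof -
  have "connected_graph (truncated_tree X n)"
  proof (rule connected_graphI[of _ "[]"])
    fix v assume "v \<in> verts (truncated_tree X n)"
    then show "([], v) \<in> (adj (truncated_tree X n))\<^sup>*"
    proof (induction v rule: rev_induct)
      case (snoc i u)
      then have v: "u @ [i] \<in> uh_verts X" "length u < n" by (auto simp: truncated_tree_def)
      then have "([], u) \<in> (adj (truncated_tree X n))\<^sup>*"
        using snoc.IH by (simp add: truncated_tree_def uh_verts_snoc)
      moreover have "{u, u @ [i]} \<in> edges (truncated_tree X n)"
        unfolding truncated_tree_def using v by auto
      then have "(u, u @ [i]) \<in> adj (truncated_tree X n)" by (simp add: adj_def)
      ultimately show ?case by (rule rtrancl_into_rtrancl)
    qed simp
  qed
  moreover have "edges (truncated_tree X n) \<subseteq> edges (uh_tree X)"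
    unfolding edges_uh_tree by (auto simp: truncated_tree_def)
  ultimately show ?thesis
    by (auto simp: rooted_subtree_def truncated_tree_def uh_tree_def uh_verts_snoc uh_verts.root)
qed

lemma card_verts_rooted_iso: "rooted_iso G H \<Longrightarrow> card (verts G) = card (verts H)"
  unfolding rooted_iso_def using bij_betw_same_card by blast

text \<open>The number of vertices is an isomorphism invariant and is unbounded over the
  truncations. Hence there are infinitely many classes, and \<open>card\<close> is 0. Having one
  constant value on all infinite trees is what makes \<open>f\<close> measurable.\<close>

lemma num_subtrees_infinite:
  assumes "infinite (uh_verts X)"
  shows "num_subtrees (uh_tree X) = 0"
proof -
  let ?C = "iso_class ` {S. rooted_subtree S (uh_tree X)}"
  define c where "c C = card (verts (SOME S. S \<in> C))" for C :: "nat list rooted_graph set"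
  have c: "c (iso_class S) = card (verts S)" if "rooted_subtree S (uh_tree X)" for S
  proof -
    have "S \<in> iso_class S"
      using that by (simp add: iso_class_def rooted_iso_refl rooted_subtree_root)
    then have "(SOME S'. S' \<in> iso_class S) \<in> iso_class S" by (rule someI)
    then show ?thesis unfolding c_def iso_class_def using card_verts_rooted_iso by fastforce
  qed
  have "infinite (c ` ?C)"
  proof
    assume "finite (c ` ?C)"
    then obtain k where k: "\<And>x. x \<in> c ` ?C \<Longrightarrow> x < k"
      unfolding finite_nat_set_iff_bounded by auto
    obtain n where n: "card {u \<in> uh_verts X. length u < n} \<ge> k"
      using card_truncation_unbounded[OF assms] by blast
    have "card {u \<in> uh_verts X. length u < n} \<le> card (verts (truncated_tree X n))"
      using finite_truncation[of X "Suc n"]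
      by (intro card_mono) (auto simp: truncated_tree_def less_Suc_eq_le)
    moreover have "card (verts (truncated_tree X n)) \<in> c ` ?C"
      using c rooted_subtree_truncated_tree by (force simp: image_iff)
    ultimately show False using k n by fastforce
  qed
  then have "infinite ?C" by blast
  then show ?thesis by (simp add: num_subtrees_eq)
qed

subsection \<open>The law of the offspring numbers\<close>

lemma space_gw_offspring: "space (gw_offspring p) = UNIV"
  by (simp add: gw_offspring_def space_PiM)

lemma prob_space_gw_offspring: "prob_space (gw_offspring p)"
  unfolding gw_offspring_def by (intro prob_space_PiM) (rule prob_space_measure_pmf)

lemma measurable_offspring [measurable]: "(\<lambda>X. X u) \<in> gw_offspring p \<rightarrow>\<^sub>M count_space UNIV"
proof -
  have "(\<lambda>X. X u) \<in> gw_offspring p \<rightarrow>\<^sub>M measure_pmf p"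
    unfolding gw_offspring_def by (rule measurable_component_singleton) simp
  then show ?thesis by simp
qed

lemma measurable_subtree_offspring [measurable]:
  "(\<lambda>X. subtree_offspring X i) \<in> gw_offspring p \<rightarrow>\<^sub>M gw_offspring p"
proof -
  have "(\<lambda>X. \<lambda>u\<in>UNIV. X (i # u)) \<in> gw_offspring p \<rightarrow>\<^sub>M gw_offspring p"
    by (subst (2) gw_offspring_def, rule measurable_restrict) simp
  then show ?thesis by (simp add: subtree_offspring_def restrict_UNIV)
qed

text \<open>The root coordinate is independent of the coordinates \<open>i # u\<close>, and these
  have the law of the whole family because the reindexing is injective. One branch at a time is
  enough, since expectations of sums over the branches are additive.\<close>

lemma nn_integral_root_subtree:
  assumes h: "h \<in> borel_measurable (measure_pmf p \<Otimes>\<^sub>M gw_offspring p)"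
  shows "(\<integral>\<^sup>+X. h (X [], subtree_offspring X i) \<partial>gw_offspring p) =
    (\<integral>\<^sup>+x. \<integral>\<^sup>+Y. h (x, Y) \<partial>gw_offspring p \<partial>measure_pmf p)"
proof -
  let ?I = "UNIV - {[]} :: nat list set"
  let ?N = "\<Pi>\<^sub>M u\<in>?I. measure_pmf p"
  let ?M = "gw_offspring p"
  have pN: "prob_space ?N" by (intro prob_space_PiM prob_space_measure_pmf)
  interpret N: prob_space ?N by (rule pN)
  have M: "distr (measure_pmf p \<Otimes>\<^sub>M ?N) ?M (\<lambda>(x, X). X([] := x)) = ?M"
    using distr_pair_PiM_eq_PiM[of ?I "\<lambda>_. measure_pmf p" "[]"]
    by (simp add: prob_space_measure_pmf gw_offspring_def insert_absorb)
  have mN: "(\<lambda>Y. \<lambda>u\<in>UNIV. Y (i # u)) \<in> ?N \<rightarrow>\<^sub>M ?M"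
    unfolding gw_offspring_def
    by (rule measurable_restrict) (rule measurable_component_singleton, simp)
  \<comment> \<open>Projection to the coordinates \<open>i # u\<close>: the branch has again the
    original law.\<close>
  have N: "distr ?N ?M (\<lambda>Y. \<lambda>u\<in>UNIV. Y (i # u)) = ?M"
    using distr_PiM_reindex[of ?I "\<lambda>_. measure_pmf p" "(#) i" UNIV]
    by (simp add: prob_space_measure_pmf gw_offspring_def)
  have mupd: "(\<lambda>(x, X). X([] := x)) \<in> measure_pmf p \<Otimes>\<^sub>M ?N \<rightarrow>\<^sub>M ?M"
    using measurable_comp[OF measurable_pair_swap' measurable_add_dim[of "[]" ?I "\<lambda>_. measure_pmf p"]]
    by (simp add: gw_offspring_def insert_absorb comp_def case_prod_beta)
  have mh: "(\<lambda>X. h (X [], subtree_offspring X i)) \<in> borel_measurable ?M"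
    using h by measurable
  have "(\<integral>\<^sup>+X. h (X [], subtree_offspring X i) \<partial>?M) =
      (\<integral>\<^sup>+X. h (X [], subtree_offspring X i) \<partial>distr (measure_pmf p \<Otimes>\<^sub>M ?N) ?M (\<lambda>(x, X). X([] := x)))"
    by (simp add: M)
  also have "\<dots> = (\<integral>\<^sup>+(x, Y). h (x, \<lambda>u\<in>UNIV. Y (i # u)) \<partial>(measure_pmf p \<Otimes>\<^sub>M ?N))"
    using mh by (subst nn_integral_distr[OF mupd])
      (auto intro!: nn_integral_cong simp: subtree_offspring_def restrict_UNIV)
  also have "\<dots> = (\<integral>\<^sup>+x. \<integral>\<^sup>+Y. h (x, \<lambda>u\<in>UNIV. Y (i # u)) \<partial>?N \<partial>measure_pmf p)"
  proof (subst N.nn_integral_fst[symmetric])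
    show "(\<lambda>(x, Y). h (x, \<lambda>u\<in>UNIV. Y (i # u))) \<in> borel_measurable (measure_pmf p \<Otimes>\<^sub>M ?N)"
      using h mN by measurable
  qed simp
  also have "\<dots> = (\<integral>\<^sup>+x. \<integral>\<^sup>+Y. h (x, Y) \<partial>distr ?N ?M (\<lambda>Y. \<lambda>u\<in>UNIV. Y (i # u)) \<partial>measure_pmf p)"
  proof (rule nn_integral_cong)
    fix x
    have "(\<lambda>Y. h (x, Y)) \<in> borel_measurable ?M" using h by measurable
    then show "(\<integral>\<^sup>+Y. h (x, \<lambda>u\<in>UNIV. Y (i # u)) \<partial>?N) =
        (\<integral>\<^sup>+Y. h (x, Y) \<partial>distr ?N ?M (\<lambda>Y. \<lambda>u\<in>UNIV. Y (i # u)))"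
      by (subst nn_integral_distr[OF mN]) simp_all
  qed
  finally show ?thesis by (simp add: N)
qed

text \<open>Moves a random number of summands into an indicator, so that measurability and the
  exchange of sum and integral follow from facts on series.\<close>

lemma sum_lessThan_eq_suminf_ennreal:
  fixes a :: "nat \<Rightarrow> ennreal"
  shows "(\<Sum>i<n. a i) = (\<Sum>i. if i < n then a i else 0)"
  by (subst suminf_finite[of "{..<n}"]) auto

lemma borel_measurable_branches [measurable (raw)]:
  fixes g :: "(nat list \<Rightarrow> nat) \<Rightarrow> ennreal"
  assumes [measurable]: "g \<in> borel_measurable (gw_offspring p)"
  shows "(\<lambda>X. \<Sum>i<X []. g (subtree_offspring X i)) \<in> borel_measurable (gw_offspring p)"
  unfolding sum_lessThan_eq_suminf_ennreal by measurable

text \<open>Wald's identity: the event \<open>i < X []\<close> depends on the root only and is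
  independent of branch \<open>i\<close>. Summing the probabilities of these events over
  \<open>i\<close> gives the mean.\<close>

lemma nn_integral_branches:
  assumes g [measurable]: "g \<in> borel_measurable (gw_offspring p)"
  shows "(\<integral>\<^sup>+X. (\<Sum>i<X []. g (subtree_offspring X i)) \<partial>gw_offspring p) =
    (\<integral>\<^sup>+x. of_nat x \<partial>measure_pmf p) * (\<integral>\<^sup>+X. g X \<partial>gw_offspring p)"
proof -
  let ?M = "gw_offspring p" and ?c = "\<integral>\<^sup>+X. g X \<partial>gw_offspring p"
  have "(\<integral>\<^sup>+X. (\<Sum>i<X []. g (subtree_offspring X i)) \<partial>?M) =
      (\<Sum>i. \<integral>\<^sup>+X. (if i < X [] then g (subtree_offspring X i) else 0) \<partial>?M)"
    unfolding sum_lessThan_eq_suminf_ennreal by (rule nn_integral_suminf) measurable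
  also have "\<dots> = (\<Sum>i. \<integral>\<^sup>+x. (if i < x then ?c else 0) \<partial>measure_pmf p)"
  proof (rule suminf_cong)
    fix i
    have "(\<lambda>z. if i < fst z then g (snd z) else 0) \<in> borel_measurable (measure_pmf p \<Otimes>\<^sub>M ?M)"
      by measurable
    from nn_integral_root_subtree[OF this, of i]
    have "(\<integral>\<^sup>+X. (if i < X [] then g (subtree_offspring X i) else 0) \<partial>?M) =
        (\<integral>\<^sup>+x. \<integral>\<^sup>+Y. (if i < x then g Y else 0) \<partial>?M \<partial>measure_pmf p)"
      by (simp only: fst_conv snd_conv)
    also have "\<dots> = (\<integral>\<^sup>+x. (if i < x then ?c else 0) \<partial>measure_pmf p)"
      by (intro nn_integral_cong) simp
    finally show "(\<integral>\<^sup>+X. (if i < X [] then g (subtree_offspring X i) else 0) \<partial>?M) =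
        (\<integral>\<^sup>+x. (if i < x then ?c else 0) \<partial>measure_pmf p)" .
  qed
  also have "\<dots> = (\<integral>\<^sup>+x. (\<Sum>i. if i < x then ?c else 0) \<partial>measure_pmf p)"
    by (rule nn_integral_suminf[symmetric]) simp
  also have "\<dots> = (\<integral>\<^sup>+x. of_nat x * ?c \<partial>measure_pmf p)"
    by (simp add: sum_lessThan_eq_suminf_ennreal[symmetric])
  also have "\<dots> = (\<integral>\<^sup>+x. of_nat x \<partial>measure_pmf p) * ?c"
    by (rule nn_integral_multc) simp
  finally show ?thesis .
qed

section \<open>The expected number of vertices\<close>

lemma card_truncation_Suc_ennreal:
  "of_nat (card {u \<in> uh_verts X. length u < Suc n}) =
     1 + (\<Sum>i<X []. of_nat (card {u \<in> uh_verts (subtree_offspring X i). length u < n}) :: ennreal)"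
  by (simp add: card_truncation_Suc)

lemma borel_measurable_card_truncation [measurable]:
  "(\<lambda>X. of_nat (card {u \<in> uh_verts X. length u < n}) :: ennreal) \<in> borel_measurable (gw_offspring p)"
proof (induction n)
  case (Suc n)
  note Suc.IH[measurable]
  show ?case unfolding card_truncation_Suc_ennreal by measurable
qed simp

text \<open>By Wald's identity the expectations satisfy \<open>e (n + 1) = 1 + \<mu> * e n\<close>,
  a recursion with fixed point \<open>1 / (1 - \<mu>)\<close>, and they start at 0, below
  it.\<close>

lemma nn_integral_card_truncation:
  assumes mean: "(\<integral>\<^sup>+x. of_nat x \<partial>measure_pmf p) = ennreal \<mu>" and \<mu>: "0 \<le> \<mu>" "\<mu> < 1"
  shows "(\<integral>\<^sup>+X. of_nat (card {u \<in> uh_verts X. length u < n}) \<partial>gw_offspring p) \<le> ennreal (1 / (1 - \<mu>))"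
proof (induction n)
  case (Suc n)
  interpret prob_space "gw_offspring p" by (rule prob_space_gw_offspring)
  have "(\<integral>\<^sup>+X. of_nat (card {u \<in> uh_verts X. length u < Suc n}) \<partial>gw_offspring p) =
      1 + ennreal \<mu> * (\<integral>\<^sup>+X. of_nat (card {u \<in> uh_verts X. length u < n}) \<partial>gw_offspring p)"
    unfolding card_truncation_Suc_ennreal
    using nn_integral_branches[OF borel_measurable_card_truncation[of n p]]
    by (subst nn_integral_add) (auto simp: mean emeasure_space_1)
  also have "\<dots> \<le> 1 + ennreal \<mu> * ennreal (1 / (1 - \<mu>))"
    using Suc.IH by (intro add_left_mono mult_left_mono) auto
  also have "\<dots> = ennreal (1 + \<mu> * (1 / (1 - \<mu>)))"
    using \<mu> by (simp only: ennreal_plus ennreal_mult ennreal_1 zero_le_one zero_le_divide_1_iff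
        mult_nonneg_nonneg diff_ge_0_iff_ge less_imp_le)
  also have "1 + \<mu> * (1 / (1 - \<mu>)) = 1 / (1 - \<mu>)"
    using \<mu> by (simp add: field_simps)
  finally show ?case .
qed simp

text \<open>Monotone convergence over the truncations. The supremum of their sizes has finite
  expectation, and it is infinite on infinite trees, which are therefore null.\<close>

lemma nn_integral_card_uh_verts:
  assumes mean: "(\<integral>\<^sup>+x. of_nat x \<partial>measure_pmf p) = ennreal \<mu>" and \<mu>: "0 \<le> \<mu>" "\<mu> < 1"
  shows "AE X in gw_offspring p. finite (uh_verts X)"
    and "(\<integral>\<^sup>+X. of_nat (card (uh_verts X)) \<partial>gw_offspring p) < \<infinity>"
proof -
  let ?c = "\<lambda>X n. of_nat (card {u \<in> uh_verts X. length u < n}) :: ennreal"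
  let ?T = "\<lambda>X. SUP n. ?c X n"
  have "incseq (\<lambda>n X. ?c X n)"
    by (intro incseq_SucI le_funI) (auto intro!: card_mono finite_truncation)
  then have "(\<integral>\<^sup>+X. ?T X \<partial>gw_offspring p) = (SUP n. \<integral>\<^sup>+X. ?c X n \<partial>gw_offspring p)"
    by (rule nn_integral_monotone_convergence_SUP) simp
  also have "\<dots> \<le> ennreal (1 / (1 - \<mu>))"
    using nn_integral_card_truncation[OF assms] by (intro SUP_least)
  finally have T: "(\<integral>\<^sup>+X. ?T X \<partial>gw_offspring p) < \<infinity>"
    by (simp add: le_less_trans)
  have inf: "?T X = \<infinity>" if "infinite (uh_verts X)" for X
  proof -
    have "\<exists>n\<in>UNIV. of_nat k \<le> ?c X n" for k
      using card_truncation_unbounded[OF that, of k] by auto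
    then have "of_nat k \<le> ?T X" for k by (meson SUP_upper2)
    then have "(SUP k. of_nat k) \<le> ?T X" by (intro SUP_least)
    then show ?thesis by (simp add: ennreal_SUP_of_nat_eq_top top_unique)
  qed
  have "AE X in gw_offspring p. ?T X \<noteq> \<infinity>"
    using T by (intro nn_integral_PInf_AE) auto
  then show "AE X in gw_offspring p. finite (uh_verts X)"
    by eventually_elim (use inf in blast)
  \<comment> \<open>For an infinite tree \<open>card\<close> is 0 and the inequality is
    trivial.\<close>
  have "of_nat (card (uh_verts X)) \<le> ?T X" for X
  proof (cases "finite (uh_verts X)")
    case True
    then obtain n where "uh_verts X \<subseteq> {u \<in> uh_verts X. length u < n}"
      using truncation_superset[OF True] by blast
    then have "uh_verts X = {u \<in> uh_verts X. length u < n}" by blast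
    then show ?thesis by (metis (no_types, lifting) SUP_upper UNIV_I)
  qed simp
  then have "(\<integral>\<^sup>+X. of_nat (card (uh_verts X)) \<partial>gw_offspring p) \<le> (\<integral>\<^sup>+X. ?T X \<partial>gw_offspring p)"
    by (intro nn_integral_mono)
  then show "(\<integral>\<^sup>+X. of_nat (card (uh_verts X)) \<partial>gw_offspring p) < \<infinity>"
    using T by (rule le_less_trans)
qed

section \<open>Measurability of functions of the tree\<close>

lemma sets_mem_uh_verts: "{X. u \<in> uh_verts X} \<in> sets (gw_offspring p)"
proof (induction u rule: rev_induct)
  case Nil
  show ?case using sets.top[of "gw_offspring p"] by (simp add: space_gw_offspring uh_verts.root)
next
  case (snoc i u)
  have "{X \<in> space (gw_offspring p). i < X u} \<in> sets (gw_offspring p)" by measurable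
  then have "{X. i < X u} \<in> sets (gw_offspring p)" by (simp add: space_gw_offspring)
  then have "{X. u \<in> uh_verts X} \<inter> {X. i < X u} \<in> sets (gw_offspring p)"
    using snoc by blast
  then show ?case by (simp add: uh_verts_snoc Collect_conj_eq)
qed

lemma sets_uh_verts_eq: "{X. uh_verts X = A} \<in> sets (gw_offspring p)"
proof -
  have "{X. u \<in> uh_verts X \<longleftrightarrow> u \<in> A} \<in> sets (gw_offspring p)" for u
    using sets_mem_uh_verts[of u p] sets.compl_sets[OF sets_mem_uh_verts[of u p]]
    by (cases "u \<in> A") (auto simp: space_gw_offspring Compl_eq_Diff_UNIV[symmetric] Collect_neg_eq)
  then have "(\<Inter>u. {X. u \<in> uh_verts X \<longleftrightarrow> u \<in> A}) \<in> sets (gw_offspring p)"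
    by (intro sets.countable_INT') auto
  also have "(\<Inter>u. {X. u \<in> uh_verts X \<longleftrightarrow> u \<in> A}) = {X. uh_verts X = A}" by auto
  finally show ?thesis .
qed

text \<open>There are only countably many finite vertex sets, and each is attained on a measurable
  event. The uncountably many infinite ones form the complement of these events, where the function
  is constant.\<close>

lemma measurable_uh_verts_function:
  assumes F: "\<And>X Y. uh_verts X = uh_verts Y \<Longrightarrow> F X = F Y"
    and inf: "\<And>X. infinite (uh_verts X) \<Longrightarrow> F X = c"
  shows "F \<in> gw_offspring p \<rightarrow>\<^sub>M count_space UNIV"
proof (rule measurableI)
  fix B
  let ?U = "\<lambda>\<A>. \<Union>A\<in>\<A>. {X. uh_verts X = A}"
  have U: "?U \<A> \<in> sets (gw_offspring p)" if "\<A> \<subseteq> Collect finite" for \<A>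
    using countable_subset[OF that countable_Collect_finite]
    by (rule sets.countable_UN') (auto simp: sets_uh_verts_eq)
  let ?A = "{A. finite A \<and> (\<exists>X. uh_verts X = A \<and> F X \<in> B)}"
  have "F -` B = ?U ?A \<union> (if c \<in> B then UNIV - ?U (Collect finite) else {})"
  proof (rule set_eqI)
    fix X
    have "F X \<in> B \<longleftrightarrow> X \<in> ?U ?A" if "finite (uh_verts X)"
    proof
      assume "X \<in> ?U ?A"
      then obtain Y where "uh_verts Y = uh_verts X" "F Y \<in> B" by blast
      then show "F X \<in> B" using F by metis
    qed (use that in blast)
    then show "X \<in> F -` B \<longleftrightarrow> X \<in> ?U ?A \<union> (if c \<in> B then UNIV - ?U (Collect finite) else {})"
      by (cases "finite (uh_verts X)") (simp_all add: inf)
  qed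
  moreover have "UNIV - ?U (Collect finite) \<in> sets (gw_offspring p)"
    using sets.compl_sets[OF U[of "Collect finite"]] by (simp add: space_gw_offspring)
  ultimately show "F -` B \<inter> space (gw_offspring p) \<in> sets (gw_offspring p)"
    using U[of ?A] by (simp add: space_gw_offspring subset_eq)
qed simp

lemma measurable_num_subtrees [measurable]:
  "(\<lambda>X. num_subtrees (uh_tree X)) \<in> gw_offspring p \<rightarrow>\<^sub>M count_space UNIV"
  by (rule measurable_uh_verts_function[of _ 0])
    (auto simp: num_subtrees_infinite dest: uh_tree_eqI)

subsection \<open>The expected logarithm\<close>

lemma sum_lessThan_eq_suminf_real:
  fixes a :: "nat \<Rightarrow> real"
  shows "(\<Sum>i<n. a i) = (\<Sum>i. if i < n then a i else 0)"
  by (subst suminf_finite[of "{..<n}"]) auto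

lemma borel_measurable_branches_real [measurable (raw)]:
  fixes g :: "(nat list \<Rightarrow> nat) \<Rightarrow> real"
  assumes [measurable]: "g \<in> borel_measurable (gw_offspring p)"
  shows "(\<lambda>X. \<Sum>i<X []. g (subtree_offspring X i)) \<in> borel_measurable (gw_offspring p)"
  unfolding sum_lessThan_eq_suminf_real by measurable

lemma expectation_branches:
  fixes g :: "(nat list \<Rightarrow> nat) \<Rightarrow> real"
  assumes mean: "(\<integral>\<^sup>+x. of_nat x \<partial>measure_pmf p) = ennreal \<mu>" and \<mu>: "0 \<le> \<mu>"
    and g: "integrable (gw_offspring p) g" and nonneg: "\<And>X. 0 \<le> g X"
  shows "integrable (gw_offspring p) (\<lambda>X. \<Sum>i<X []. g (subtree_offspring X i))"
    and "(\<integral>X. (\<Sum>i<X []. g (subtree_offspring X i)) \<partial>gw_offspring p) = \<mu> * (\<integral>X. g X \<partial>gw_offspring p)"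
proof -
  let ?G = "\<lambda>X. \<Sum>i<X []. g (subtree_offspring X i)"
  have [measurable]: "g \<in> borel_measurable (gw_offspring p)" using g by simp
  have G0: "0 \<le> ?G X" for X by (intro sum_nonneg nonneg)
  have "(\<integral>\<^sup>+X. ennreal (?G X) \<partial>gw_offspring p) =
      (\<integral>\<^sup>+X. (\<Sum>i<X []. ennreal (g (subtree_offspring X i))) \<partial>gw_offspring p)"
    by (simp add: nonneg sum_ennreal)
  also have "\<dots> = ennreal \<mu> * (\<integral>\<^sup>+X. ennreal (g X) \<partial>gw_offspring p)"
    by (subst nn_integral_branches) (simp_all add: mean)
  also have "\<dots> = ennreal (\<mu> * (\<integral>X. g X \<partial>gw_offspring p))"
    using g nonneg \<mu> by (simp add: nn_integral_eq_integral ennreal_mult integral_nonneg)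
  finally have *: "(\<integral>\<^sup>+X. ennreal (?G X) \<partial>gw_offspring p) = ennreal (\<mu> * (\<integral>X. g X \<partial>gw_offspring p))" .
  then show "integrable (gw_offspring p) ?G"
    by (intro integrableI_nonneg) (auto simp: G0)
  show "(\<integral>X. ?G X \<partial>gw_offspring p) = \<mu> * (\<integral>X. g X \<partial>gw_offspring p)"
    using * \<mu> nonneg by (subst integral_eq_nn_integral) (auto simp: G0 integral_nonneg)
qed

lemma prob_root_childless: "measure (gw_offspring p) {X. X [] = k} = pmf p k"
  and prob_single_edge: "measure (gw_offspring p) {X. X [] = 1 \<and> X [0] = 0} = pmf p 1 * pmf p 0"
proof -
  interpret product_prob_space "\<lambda>_. measure_pmf p" "UNIV :: nat list set"
    by unfold_locales
  have "emeasure (gw_offspring p) {X. X [] = k} = ennreal (pmf p k)"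
    using emeasure_PiM_Collect[of "{[]}" "\<lambda>_. {k}"]
    by (simp add: space_gw_offspring flip: gw_offspring_def) (simp add: emeasure_pmf_single)
  then show "measure (gw_offspring p) {X. X [] = k} = pmf p k"
    by (simp add: measure_def)
  have "emeasure (gw_offspring p) {X. X [] = 1 \<and> X [0] = 0} = ennreal (pmf p 1) * ennreal (pmf p 0)"
    using emeasure_PiM_Collect[of "{[], [0]}" "\<lambda>u. if u = [] then {1} else {0}"]
    by (simp add: space_gw_offspring flip: gw_offspring_def) (simp add: emeasure_pmf_single)
  then show "measure (gw_offspring p) {X. X [] = 1 \<and> X [0] = 0} = pmf p 1 * pmf p 0"
    by (simp add: measure_def enn2real_mult)
qed

text \<open>Finiteness of the expectation is what allows the \<mu>-fold multiple of it to be moved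
  across the recursive inequality. The pointwise bound survives on infinite trees, where both sides
  are 0.\<close>

lemma integrable_ln_num_subtrees:
  assumes mean: "(\<integral>\<^sup>+x. of_nat x \<partial>measure_pmf p) = ennreal \<mu>" and \<mu>: "0 \<le> \<mu>" "\<mu> < 1"
  shows "integrable (gw_offspring p) (\<lambda>X. ln (real (num_subtrees (uh_tree X))))"
proof -
  have "ln (real (num_subtrees (uh_tree X))) \<le> ln 4 * real (card (uh_verts X))" for X
  proof (cases "finite (uh_verts X)")
    case True
    have "real (num_subtrees (uh_tree X)) \<le> 4 ^ card (uh_verts X)"
      using num_subtrees_le[OF True] by (metis of_nat_le_iff of_nat_numeral of_nat_power)
    then have "ln (real (num_subtrees (uh_tree X))) \<le> ln (4 ^ card (uh_verts X))"
      using num_subtrees_pos[OF True] by (subst ln_le_cancel_iff) auto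
    then show ?thesis by (simp add: ln_realpow mult.commute)
  qed (simp add: num_subtrees_infinite)
  then have "(\<integral>\<^sup>+X. ennreal (ln (real (num_subtrees (uh_tree X)))) \<partial>gw_offspring p)
      \<le> (\<integral>\<^sup>+X. ennreal (ln 4) * of_nat (card (uh_verts X)) \<partial>gw_offspring p)"
    by (intro nn_integral_mono)
      (simp add: ennreal_of_nat_eq_real_of_nat ennreal_leI flip: ennreal_mult)
  also have "\<dots> = ennreal (ln 4) * (\<integral>\<^sup>+X. of_nat (card (uh_verts X)) \<partial>gw_offspring p)"
  proof (rule nn_integral_cmult)
    have "(\<lambda>X. card (uh_verts X)) \<in> gw_offspring p \<rightarrow>\<^sub>M count_space UNIV"
      by (rule measurable_uh_verts_function[of _ 0]) auto
    then show "(\<lambda>X. of_nat (card (uh_verts X)) :: ennreal) \<in> borel_measurable (gw_offspring p)"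
      by measurable
  qed
  also have "\<dots> < \<infinity>"
    using nn_integral_card_uh_verts(2)[OF assms] by (simp add: ennreal_mult_less_top)
  finally have "(\<integral>\<^sup>+X. ennreal (ln (real (num_subtrees (uh_tree X)))) \<partial>gw_offspring p) < \<infinity>" .
  moreover have "0 \<le> ln (real n)" for n by (cases n) auto
  ultimately show ?thesis by (intro integrableI_nonneg) auto
qed

lemma ln_num_subtrees_ge:
  assumes fin: "finite (uh_verts X)"
  shows "(\<Sum>i<X []. ln (1 + real (num_subtrees (uh_tree (subtree_offspring X i))))) - ln (fact (X []))
    \<le> ln (real (num_subtrees (uh_tree X)))"
proof -
  let ?f = "\<lambda>X. real (num_subtrees (uh_tree X))"
  have "(\<Prod>i<X []. 1 + ?f (subtree_offspring X i)) \<le> fact (X []) * ?f X"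
    using of_nat_mono[OF prod_num_subtrees_le[OF fin], where 'a = real] by simp
  then have "ln (\<Prod>i<X []. 1 + ?f (subtree_offspring X i)) \<le> ln (fact (X []) * ?f X)"
    using num_subtrees_pos[OF fin]
    by (subst ln_le_cancel_iff) (auto intro!: prod_pos simp: add_pos_nonneg)
  also have "\<dots> = ln (fact (X [])) + ln (?f X)"
    using num_subtrees_pos[OF fin] by (subst ln_mult) auto
  finally show ?thesis by (subst (asm) ln_prod) (auto simp: add_pos_nonneg)
qed

text \<open>The difference \<open>ln (1 + n) - ln n = ln (1 + 1/n)\<close> is kept for the two
  smallest trees, where \<open>n\<close> is at most 1 and 2, and is estimated by 0 on all
  others.\<close>

lemma ln_Suc_num_subtrees_ge:
  assumes fin: "finite (uh_verts X)"
  shows "ln (real (num_subtrees (uh_tree X))) + ln 2 * indicator {X. X [] = 0} X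
      + ln (3/2) * indicator {X. X [] = 1 \<and> X [0] = 0} X
    \<le> ln (1 + real (num_subtrees (uh_tree X)))"
proof -
  define n where "n = real (num_subtrees (uh_tree X))"
  have n: "n \<ge> 1" using num_subtrees_pos[OF fin] by (simp add: n_def)
  consider "X [] = 0" | "X [] = 1" "X [0] = 0" | "X [] \<noteq> 0" "\<not> (X [] = 1 \<and> X [0] = 0)" by metis
  then have "ln n + ln 2 * indicator {X. X [] = 0} X
      + ln (3/2) * indicator {X. X [] = 1 \<and> X [0] = 0} X \<le> ln (1 + n)"
  proof cases
    case 1
    then have "n = 1" using num_subtrees_leaf[of X] n by (simp add: n_def)
    then show ?thesis using 1 by simp
  next
    case 2
    then have "n \<le> 2" using num_subtrees_edge[of X] by (simp add: n_def)
    then have "ln (n * (3/2)) \<le> ln (1 + n)" using n by (subst ln_le_cancel_iff) auto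
    moreover have "ln (n * (3/2)) = ln n + ln (3/2)" using n by (intro ln_mult_pos) auto
    ultimately show ?thesis using 2 by simp
  next
    case 3
    then show ?thesis using n by simp
  qed
  then show ?thesis by (simp add: n_def)
qed

text \<open>Two integrated inequalities are combined through \<open>g = ln (1 + f)\<close>: the
  product bound gives \<open>m\<close> from below in terms of the integral of \<open>g\<close>, and
  the gain on small trees gives that integral from below in terms of \<open>m\<close>.\<close>

lemma expectation_ln_num_subtrees_ge:
  assumes mean: "(\<integral>\<^sup>+x. of_nat x \<partial>measure_pmf p) = ennreal \<mu>" and \<mu>: "0 \<le> \<mu>" "\<mu> < 1"
    and fact: "integrable (measure_pmf p) (\<lambda>k. ln (fact k) :: real)"
  shows "\<mu> * (ln 2 * pmf p 0 + ln (3/2) * (pmf p 1 * pmf p 0)) - measure_pmf.expectation p (\<lambda>k. ln (fact k))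
    \<le> (1 - \<mu>) * (\<integral>X. ln (real (num_subtrees (uh_tree X))) \<partial>gw_offspring p)"
proof -
  interpret prob_space "gw_offspring p" by (rule prob_space_gw_offspring)
  define L where "L X = ln (real (num_subtrees (uh_tree X)))" for X
  define g where "g X = ln (1 + real (num_subtrees (uh_tree X)))" for X
  have L [measurable]: "L \<in> borel_measurable (gw_offspring p)"
    and g [measurable]: "g \<in> borel_measurable (gw_offspring p)"
    unfolding L_def g_def by measurable
  have iL: "integrable (gw_offspring p) L"
    unfolding L_def by (rule integrable_ln_num_subtrees[OF mean \<mu>])
  have L0: "0 \<le> L X" for X by (cases "num_subtrees (uh_tree X)") (auto simp: L_def)
  have g0: "0 \<le> g X" for X by (simp add: g_def)
  \<comment> \<open>From \<open>1 + f \<le> 2 * f\<close> for \<open>f \<ge> 1\<close>; it makes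
    \<open>g\<close> integrable. For \<open>f = 0\<close> both logarithms are 0.\<close>
  have gL: "g X \<le> ln 2 + L X" for X
  proof (cases "num_subtrees (uh_tree X) = 0")
    case False
    then have "g X \<le> ln (2 * real (num_subtrees (uh_tree X)))"
      unfolding g_def by (subst ln_le_cancel_iff) auto
    then show ?thesis using False by (simp add: ln_mult L_def)
  qed (simp add: g_def L_def)
  have ig: "integrable (gw_offspring p) g"
    by (rule Bochner_Integration.integrable_bound[of _ "\<lambda>X. ln 2 + L X"]) (use iL gL g0 L0 in auto)
  have AEf: "AE X in gw_offspring p. finite (uh_verts X)"
    by (rule nn_integral_card_uh_verts(1)[OF mean \<mu>])
  have D: "distr (gw_offspring p) (measure_pmf p) (\<lambda>X. X []) = measure_pmf p"
    unfolding gw_offspring_def by (rule distr_PiM_component) (auto simp: prob_space_measure_pmf)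
  have mD: "(\<lambda>X. X []) \<in> gw_offspring p \<rightarrow>\<^sub>M measure_pmf p" by simp
  have iF: "integrable (gw_offspring p) (\<lambda>X. ln (fact (X [])) :: real)"
    using fact by (subst (asm) D[symmetric], subst (asm) integrable_distr_eq[OF mD]) auto
  have "(\<integral>k. ln (fact k) \<partial>distr (gw_offspring p) (measure_pmf p) (\<lambda>X. X [])) =
      (\<integral>X. ln (fact (X [])) \<partial>gw_offspring p :: real)"
    by (rule integral_distr[OF mD]) simp
  then have eF: "(\<integral>X. ln (fact (X [])) \<partial>gw_offspring p) =
      measure_pmf.expectation p (\<lambda>k. ln (fact k) :: real)"
    by (simp only: D)
  note G = expectation_branches[OF mean \<mu>(1) ig g0]
  have "(\<integral>X. (\<Sum>i<X []. g (subtree_offspring X i)) - ln (fact (X [])) \<partial>gw_offspring p)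
      \<le> (\<integral>X. L X \<partial>gw_offspring p)"
  proof (rule integral_mono_AE)
    show "AE X in gw_offspring p. (\<Sum>i<X []. g (subtree_offspring X i)) - ln (fact (X [])) \<le> L X"
      using AEf by eventually_elim (simp add: g_def L_def ln_num_subtrees_ge)
  qed (use G(1) iF iL in auto)
  then have 1: "\<mu> * (\<integral>X. g X \<partial>gw_offspring p) - measure_pmf.expectation p (\<lambda>k. ln (fact k))
      \<le> (\<integral>X. L X \<partial>gw_offspring p)"
    using G iF by (simp add: eF)
  let ?A = "{X :: nat list \<Rightarrow> nat. X [] = 0}" and ?B = "{X :: nat list \<Rightarrow> nat. X [] = 1 \<and> X [0] = 0}"
  have "{X \<in> space (gw_offspring p). X [] = 0} \<in> sets (gw_offspring p)"
    "{X \<in> space (gw_offspring p). X [] = 1 \<and> X [0] = 0} \<in> sets (gw_offspring p)"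
    by measurable
  then have AB [measurable]: "?A \<in> sets (gw_offspring p)" "?B \<in> sets (gw_offspring p)"
    by (simp_all add: space_gw_offspring)
  have iA: "integrable (gw_offspring p) (\<lambda>X. ln 2 * indicator ?A X :: real)"
    "integrable (gw_offspring p) (\<lambda>X. ln (3/2) * indicator ?B X :: real)"
    using AB by (auto intro!: integrable_mult_right integrable_real_indicator simp: less_top[symmetric])
  have "(\<integral>X. L X + ln 2 * indicator ?A X + ln (3/2) * indicator ?B X \<partial>gw_offspring p)
      \<le> (\<integral>X. g X \<partial>gw_offspring p)"
  proof (rule integral_mono_AE)
    show "AE X in gw_offspring p.
        L X + ln 2 * indicator ?A X + ln (3/2) * indicator ?B X \<le> g X"
      using AEf by eventually_elim (unfold L_def g_def, rule ln_Suc_num_subtrees_ge)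
  qed (use iA iL ig in auto)
  then have "(\<integral>X. L X \<partial>gw_offspring p) + ln 2 * pmf p 0 + ln (3/2) * (pmf p 1 * pmf p 0)
      \<le> (\<integral>X. g X \<partial>gw_offspring p)"
    using iA iL AB prob_root_childless[of p 0] prob_single_edge[of p]
    by (simp add: space_gw_offspring)
  then have "\<mu> * ((\<integral>X. L X \<partial>gw_offspring p) + ln 2 * pmf p 0 + ln (3/2) * (pmf p 1 * pmf p 0))
      \<le> \<mu> * (\<integral>X. g X \<partial>gw_offspring p)"
    using \<mu>(1) by (rule mult_left_mono)
  with 1 show ?thesis unfolding L_def[symmetric] by (simp add: algebra_simps)
qed

section \<open>Poisson estimates and numerical bounds\<close>

lemma nn_integral_poisson_of_nat:
  assumes "0 < \<mu>"
  shows "(\<integral>\<^sup>+x. of_nat x \<partial>measure_pmf (poisson_pmf \<mu>)) = ennreal \<mu>"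
proof -
  have "(\<lambda>n. \<mu> ^ n /\<^sub>R fact n) sums exp \<mu>" by (rule exp_converges)
  then have "(\<lambda>n. (\<mu> * exp (-\<mu>)) * (\<mu> ^ n /\<^sub>R fact n)) sums ((\<mu> * exp (-\<mu>)) * exp \<mu>)"
    by (rule sums_mult)
  also have "(\<mu> * exp (-\<mu>)) * exp \<mu> = \<mu>" by (simp add: exp_minus)
  also have "(\<lambda>n. (\<mu> * exp (-\<mu>)) * (\<mu> ^ n /\<^sub>R fact n)) =
      (\<lambda>n. pmf (poisson_pmf \<mu>) (Suc n) * real (Suc n))"
    using assms by (auto simp: field_simps simp del: of_nat_Suc)
  finally have "(\<lambda>n. pmf (poisson_pmf \<mu>) n * real n) sums \<mu>"
    by (subst (asm) sums_Suc_iff) simp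
  then have "(\<Sum>n. ennreal (pmf (poisson_pmf \<mu>) n * real n)) = ennreal \<mu>"
    using assms by (subst suminf_ennreal2) (auto simp: sums_iff)
  moreover have "(\<integral>\<^sup>+x. of_nat x \<partial>measure_pmf (poisson_pmf \<mu>)) =
      (\<Sum>n. ennreal (pmf (poisson_pmf \<mu>) n * real n))"
    by (simp add: nn_integral_measure_pmf nn_integral_count_space_nat ennreal_mult
        ennreal_of_nat_eq_real_of_nat del: pmf_poisson)
  ultimately show ?thesis by simp
qed

text \<open>The sum of \<open>ln j \<le> j - 1\<close> over the factors. The quadratic form is
  chosen because it cancels the two leading factors of \<open>fact (n + 2)\<close>, which leaves
  half a term of the series of \<open>exp 1\<close>.\<close>

lemma ln_fact_le: "ln (fact (n + 2) :: real) \<le> real ((n + 2) * (n + 1)) / 2"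
proof (induction n)
  case 0
  have "ln 2 \<le> (2 - 1 :: real)" by (rule ln_le_minus_one) simp
  then show ?case by simp
next
  case (Suc n)
  have "fact (Suc n + 2) = real (n + 3) * fact (n + 2)" by (simp add: algebra_simps)
  then have "ln (fact (Suc n + 2)) = ln (real (n + 3)) + ln (fact (n + 2) :: real)"
    by (simp only:) (rule ln_mult_pos, auto)
  also have "ln (real (n + 3)) \<le> real (n + 3) - 1" by (rule ln_le_minus_one) simp
  finally show ?case using Suc by (simp add: algebra_simps)
qed

lemma ln_fact_divide_fact_le: "ln (fact (n + 2)) / fact (n + 2) \<le> 1 / (2 * fact n :: real)"
proof -
  have "ln (fact (n + 2)) / fact (n + 2) \<le> (real ((n + 2) * (n + 1)) / 2) / fact (n + 2)"
    by (intro divide_right_mono ln_fact_le) simp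
  also have "\<dots> = real ((n + 2) * (n + 1)) / 2 / (real ((n + 2) * (n + 1)) * fact n)"
    by (simp add: algebra_simps)
  also have "\<dots> = 1 / (2 * fact n)"
    by (simp del: of_nat_mult of_nat_add)
  finally show ?thesis .
qed

text \<open>The first seven terms are exact; the later ones are compared with the exponential series.\<close>
lemma ln_fact_sums_bound:
  shows "summable (\<lambda>k. ln (fact k) / fact k :: real)" (is "summable ?c")
    and "(\<Sum>k. ln (fact k) / fact k :: real) \<le> 74/90 * ln 2 + 79/360 * ln 3 + 7/720 * ln 5 + (exp 1 - 65/24) / 2"
proof -
  have e: "(\<lambda>n. 1 / fact n :: real) sums exp 1"
    using exp_converges[of "1 :: real"] by (simp add: divide_inverse)
  then have e2: "(\<lambda>n. 1 / (2 * fact n) :: real) sums (exp 1 / 2)"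
    using sums_divide[OF e, of 2] by (simp add: field_simps)
  have c0: "0 \<le> ?c k" for k by (simp add: fact_ge_1)
  have "norm (?c (n + 2)) \<le> 1 / (2 * fact n)" for n
    using ln_fact_divide_fact_le[of n] c0[of "n + 2"] by (simp only: real_norm_def abs_of_nonneg)
  then have "summable (\<lambda>n. ?c (n + 2))"
    by (rule summable_comparison_test'[OF sums_summable[OF e2]])
  then show s: "summable ?c" by (subst (asm) summable_iff_shift)
  \<comment> \<open>Index 7 of the logarithmic series corresponds to index 5 of the exponential one.
    The removed terms 1, 1, 1/2, 1/6, 1/24 add up to 65/24.\<close>
  have e5: "(\<Sum>n. 1 / (2 * fact (n + 5)) :: real) = exp 1 / 2 - (\<Sum>n<5. 1 / (2 * fact n))"
    using suminf_split_initial_segment[OF sums_summable[OF e2], of 5] sums_unique[OF e2] by linarith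
  have "(\<Sum>k. ?c (k + 7)) \<le> (\<Sum>n. 1 / (2 * fact (n + 5)))"
  proof (rule suminf_le)
    fix n show "?c (n + 7) \<le> 1 / (2 * fact (n + 5))"
      using ln_fact_divide_fact_le[of "n + 5"] by (simp add: add.commute add.assoc)
    show "summable (\<lambda>k. ?c (k + 7))" using s by (subst summable_iff_shift)
    show "summable (\<lambda>n. 1 / (2 * fact (n + 5)) :: real)"
      using sums_summable[OF e2] by (subst summable_iff_shift)
  qed
  also have "\<dots> = (exp 1 - 65/24) / 2"
    unfolding e5 by (simp add: eval_nat_numeral)
  finally have t: "(\<Sum>k. ?c (k + 7)) \<le> (exp 1 - 65/24) / 2" .
  have l6: "ln 6 = ln 2 + ln (3::real)" using ln_mult[of 2 3] by simp
  have l24: "ln 24 = 3 * ln 2 + ln (3::real)" using ln_mult[of 8 3] ln_realpow[of 2 3] by simp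
  have l120: "ln 120 = 3 * ln 2 + ln 3 + ln (5::real)" using ln_mult[of 24 5] l24 by simp
  have l720: "ln 720 = 4 * ln 2 + 2 * ln 3 + ln (5::real)" using ln_mult[of 120 6] l120 l6 by simp
  \<comment> \<open>The prime factorisations of 2, 6, 24, 120 and 720, with the coefficients of each
    logarithm collected.\<close>
  have "(\<Sum>k<7. ?c k) = 74/90 * ln 2 + 79/360 * ln 3 + 7/720 * ln 5"
    by (simp add: eval_nat_numeral) (simp add: l6 l24 l120 l720 field_simps)
  then show "(\<Sum>k. ?c k) \<le> 74/90 * ln 2 + 79/360 * ln 3 + 7/720 * ln 5 + (exp 1 - 65/24) / 2"
    using suminf_split_initial_segment[OF s, of 7] t by simp
qed

text \<open>Only \<open>\<mu> ^ k \<le> 1\<close> is used. The factor \<open>exp (-\<mu>)\<close> is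
  kept, because the gain terms carry the same factor and it can be taken out of the whole
  balance.\<close>

lemma expectation_poisson_ln_fact:
  assumes "0 < \<mu>" "\<mu> \<le> 1"
  shows "integrable (measure_pmf (poisson_pmf \<mu>)) (\<lambda>k. ln (fact k) :: real)"
    and "measure_pmf.expectation (poisson_pmf \<mu>) (\<lambda>k. ln (fact k)) \<le> exp (-\<mu>) * (\<Sum>k. ln (fact k) / fact k)"
proof -
  let ?p = "poisson_pmf \<mu>" and ?s = "\<Sum>k. ln (fact k) / fact k :: real"
  have l0: "0 \<le> ln (fact k :: real)" for k by (simp add: fact_ge_1)
  have b: "pmf ?p k * ln (fact k) \<le> exp (-\<mu>) * (ln (fact k) / fact k)" for k
  proof -
    have "\<mu> ^ k * (exp (-\<mu>) * (ln (fact k) / fact k)) \<le> 1 * (exp (-\<mu>) * (ln (fact k) / fact k))"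
      using assms l0 by (intro mult_right_mono power_le_one) auto
    then show ?thesis using assms by (simp add: mult_ac)
  qed
  have "(\<integral>\<^sup>+k. ennreal (ln (fact k)) \<partial>measure_pmf ?p) = (\<Sum>k. ennreal (pmf ?p k * ln (fact k)))"
    by (simp add: nn_integral_measure_pmf nn_integral_count_space_nat ennreal_mult l0 del: pmf_poisson)
  also have "\<dots> \<le> (\<Sum>k. ennreal (exp (-\<mu>) * (ln (fact k) / fact k)))"
    using b by (intro suminf_le) (auto intro: ennreal_leI)
  also have "\<dots> = ennreal (\<Sum>k. exp (-\<mu>) * (ln (fact k) / fact k))"
    by (rule suminf_ennreal2) (use l0 in simp, rule summable_mult[OF ln_fact_sums_bound(1)])
  also have "\<dots> = ennreal (exp (-\<mu>) * ?s)"
    by (subst suminf_mult[OF ln_fact_sums_bound(1)]) (rule refl)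
  finally have le: "(\<integral>\<^sup>+k. ennreal (ln (fact k)) \<partial>measure_pmf ?p) \<le> ennreal (exp (-\<mu>) * ?s)" .
  then show "integrable (measure_pmf ?p) (\<lambda>k. ln (fact k) :: real)"
    using l0 by (intro integrableI_nonneg) (auto intro: le_less_trans)
  have "0 \<le> ?s" using l0 by (intro suminf_nonneg ln_fact_sums_bound(1)) auto
  then show "measure_pmf.expectation ?p (\<lambda>k. ln (fact k)) \<le> exp (-\<mu>) * ?s"
    using le l0 by (subst integral_eq_nn_integral) (auto intro!: enn2real_leI)
qed

text \<open>The balance of gain and loss after division by \<open>exp (-\<mu>)\<close>, with 2.72 in
  place of \<open>exp \<mu>\<close>. At \<mu> = 1 the slack is about 0.0015; lowering \<mu> by
  1/10000 costs about 0.0001, which is why that range is safe.\<close>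

lemma numerical_bound:
  assumes "9999/10000 \<le> (\<mu>::real)" "\<mu> \<le> 1"
  shows "0.003 * 2.72 < \<mu> * (ln 2 + \<mu> / 2.72 * ln (3/2)) - (\<Sum>k. ln (fact k) / fact k)"
proof -
  have l2: "ln (2::real) \<le> 0.69316" "0.6931 \<le> ln (2::real)"
    using ln_approx_bounds[of 2 4] by (simp_all add: eval_nat_numeral)
  have l3: "1.0985 \<le> ln (3::real)"
    using ln_approx_bounds[of 3 6] by (simp add: eval_nat_numeral)
  have l5: "ln (5::real) \<le> 1.615"
    using ln_approx_bounds[of 5 6] by (simp add: eval_nat_numeral)
  have l32: "ln (3/2) = ln 3 - ln (2::real)" by (simp add: ln_div)
  have \<mu>: "9999/10000 * (ln 2 + 9999/10000 / 2.72 * ln (3/2)) \<le> \<mu> * (ln 2 + \<mu> / 2.72 * ln (3/2))"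
    using assms l2 l3 l32 by (intro mult_mono add_mono divide_right_mono) auto
  have e: "exp 1 < (2.72 :: real)" using e_less_272 by simp
  have "(\<Sum>k. ln (fact k) / fact k :: real)
      \<le> 74/90 * ln 2 + 79/360 * ln 3 + 7/720 * ln 5 + (exp 1 - 65/24) / 2"
    by (rule ln_fact_sums_bound(2))
  also have "\<dots> \<le> 74/90 * ln 2 + 79/360 * ln 3 + 7/720 * ln 5 + (2.72 - 65/24) / 2"
    using e by (intro add_left_mono divide_right_mono diff_right_mono) auto
  finally have s: "(\<Sum>k. ln (fact k) / fact k :: real)
      \<le> 74/90 * ln 2 + 79/360 * ln 3 + 7/720 * ln 5 + (2.72 - 65/24) / 2" .
  \<comment> \<open>After collecting terms, \<open>ln 2\<close> and \<open>ln 5\<close> have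
    negative coefficients and \<open>ln 3\<close> a positive one; this decides which one-sided
    approximations are critical.\<close>
  have "(0.003 :: real) * 2.72 < 9999/10000 * (ln 2 + 9999/10000 / 2.72 * ln (3/2))
      - (74/90 * ln 2 + 79/360 * ln 3 + 7/720 * ln 5 + (2.72 - 65/24) / 2)"
    unfolding l32 using l2 l3 l5 by (simp add: field_simps)
  also have "\<dots> \<le> \<mu> * (ln 2 + \<mu> / 2.72 * ln (3/2)) - (\<Sum>k. ln (fact k) / fact k)"
    using \<mu> s by (rule diff_mono)
  finally show ?thesis .
qed

theorem claim7p1:
  shows "\<exists>\<epsilon>\<^sub>0::real. 0 < \<epsilon>\<^sub>0 \<and>
    (\<forall>\<epsilon>::real. 0 < \<epsilon> \<and> \<epsilon> < \<epsilon>\<^sub>0 \<longrightarrow>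
      prob_space.expectation (gw_offspring (poisson_pmf (1 - \<epsilon>)))
        (\<lambda>X. ln (real (num_subtrees (uh_tree X)))) > 0.003 / \<epsilon>)"
proof (intro exI[of _ "1/10000"] conjI allI impI)
  fix \<epsilon> :: real
  assume \<epsilon>: "0 < \<epsilon> \<and> \<epsilon> < 1/10000"
  define \<mu> where "\<mu> = 1 - \<epsilon>"
  let ?p = "poisson_pmf \<mu>" and ?s = "\<Sum>k. ln (fact k) / fact k :: real"
  define m where "m = (\<integral>X. ln (real (num_subtrees (uh_tree X))) \<partial>gw_offspring ?p)"
  have \<mu>: "0 < \<mu>" "\<mu> < 1" "9999/10000 \<le> \<mu>" using \<epsilon> by (auto simp: \<mu>_def)
  have "\<mu> * (ln 2 * pmf ?p 0 + ln (3/2) * (pmf ?p 1 * pmf ?p 0)) - measure_pmf.expectation ?p (\<lambda>k. ln (fact k))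
      \<le> (1 - \<mu>) * m"
    unfolding m_def using \<mu>
    by (intro expectation_ln_num_subtrees_ge nn_integral_poisson_of_nat expectation_poisson_ln_fact) auto
  \<comment> \<open>The point masses at 0 and 1 are \<open>exp (-\<mu>)\<close> and
    \<open>\<mu> * exp (-\<mu>)\<close>, so \<open>exp (-\<mu>)\<close> is a common factor of gain
    and loss.\<close>
  then have m: "exp (-\<mu>) * (\<mu> * (ln 2 + \<mu> * exp (-\<mu>) * ln (3/2)) - ?s) \<le> \<epsilon> * m"
    using expectation_poisson_ln_fact(2)[of \<mu>] \<mu> by (simp add: \<mu>_def algebra_simps)
  have "exp \<mu> \<le> exp 1" using \<mu> by simp
  moreover have "exp 1 < (2.72 :: real)" using e_less_272 by simp
  ultimately have "exp \<mu> \<le> 2.72" by linarith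
  then have e: "1 / 2.72 \<le> exp (-\<mu>)" by (simp add: exp_minus field_simps)
  let ?K = "\<mu> * (ln 2 + \<mu> / 2.72 * ln (3/2)) - ?s"
  have K: "0.003 * 2.72 < ?K" using numerical_bound \<mu> by simp
  have "0.003 = 1 / 2.72 * (0.003 * 2.72 :: real)" by simp
  also have "\<dots> < 1 / 2.72 * ?K" using K by simp
  \<comment> \<open>\<open>1 / 2.72 \<le> exp (-\<mu>)\<close> enters twice, outside and then inside
    the bracket. The outer use needs the bracket to be positive, which \<open>K\<close>
    provides.\<close>
  also have "\<dots> \<le> exp (-\<mu>) * ?K" using e K by (intro mult_right_mono) auto
  also have "\<dots> \<le> exp (-\<mu>) * (\<mu> * (ln 2 + \<mu> * exp (-\<mu>) * ln (3/2)) - ?s)"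
  proof -
    have "\<mu> * (1 / 2.72) * ln (3/2) \<le> \<mu> * exp (-\<mu>) * ln (3/2)"
      using e \<mu> by (intro mult_right_mono mult_left_mono) auto
    then show ?thesis
      using \<mu> by (intro mult_left_mono diff_right_mono add_left_mono) auto
  qed
  also note m
  finally show "0.003 / \<epsilon> < prob_space.expectation (gw_offspring (poisson_pmf (1 - \<epsilon>)))
      (\<lambda>X. ln (real (num_subtrees (uh_tree X))))"
    using \<epsilon> by (simp add: m_def \<mu>_def field_simps)
qed simp

end
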